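(* There exist constants $c>0$ and $n_0$ such that for every $n\ge n_0$ the number of distinct K-USOs of the $n$-cube is at least $2^{c n^3}$; i.e., the number of $n$-dimensional K-USOs is $2^{\Omega(n^3)}$. Consequently (together with the upper bound $2^{O(n^3)}$ for P-USOs), the numbers of $n$-dimensional K-USOs and of P-USOs are both $2^{\Theta(n^3)}$.
   Context: For $v\in\{0,1\}^n$ and $I\subseteq[n]$, $v\oplus I$ flips the coordinates of $v$ in $I$; $v\oplus i=v\oplus\{i\}$. The $n$-cube has vertex set $\{0,1\}^n$ and edges $\{v,v\oplus i\}$; a unique-sink orientation (USO) is an orientation in which every subcube (induced subgraph on $\{v\oplus I: I\subseteq C\}$, $C\subseteq[n]$) has exactly one sink. A P-matrix is a square real matrix with all principal minors positive; a Z-matrix is a square matrix with all off-diagonal entries non-positive; a K-matrix is a matrix that is both a Z-matrix and a P-matrix. For $B\subseteq[n]$, $A_B$ is the matrix whose $i$th column is the $i$th column of $-M$ if $i\in B$ and of $I_n$ otherwise; $B(v)=\{j:v_j=1\}$. A pair $(M,q)$ with $M$ a P-matrix is nondegenerate if $(A_B^{-1}q)_i\ne0$ for all $B,i$; the USO induced by $\mathrm{LCP}(M,q)$ is given by $v\to v\oplus i$ iff $(A_{B(v)}^{-1}q)_i<0$. A K-USO (resp. P-USO) is a USO induced in this way by some nondegenerate $(M,q)$ with $M$ a K-matrix (resp. P-matrix). *)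

theory Defs
  imports "Jordan_Normal_Form.Determinant" "Jordan_Normal_Form.DL_Submatrix"
begin

text \<open>Vertices of the n-cube are identified with their supports B(v) = {j. v_j = 1},
  i.e. subsets of {..<n} (coordinates are 0-based). Flipping coordinates in I is
  symmetric difference.\<close>

definition flip :: "nat set \<Rightarrow> nat set \<Rightarrow> nat set" where
  "flip v I = (v - I) \<union> (I - v)"

text \<open>An orientation of the n-cube is encoded canonically as a predicate
  Or v i = "the edge {v, v xor i} is directed v -> v xor i", for v a vertex and i < n,
  and False outside the cube (so that distinct orientations are distinct functions).\<close>

definition is_orientation :: "nat \<Rightarrow> (nat set \<Rightarrow> nat \<Rightarrow> bool) \<Rightarrow> bool" where
  "is_orientation n Or \<longleftrightarrow>
     (\<forall>v i. \<not> (v \<subseteq> {..<n} \<and> i < n) \<longrightarrow> \<not> Or v i) \<and>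
     (\<forall>v i. v \<subseteq> {..<n} \<and> i < n \<longrightarrow> (Or v i \<longleftrightarrow> \<not> Or (flip v {i}) i))"

definition is_USO :: "nat \<Rightarrow> (nat set \<Rightarrow> nat \<Rightarrow> bool) \<Rightarrow> bool" where
  "is_USO n Or \<longleftrightarrow> is_orientation n Or \<and>
     (\<forall>C v. C \<subseteq> {..<n} \<longrightarrow> v \<subseteq> {..<n} \<longrightarrow>
        (\<exists>!w. w \<in> {flip v I | I. I \<subseteq> C} \<and> (\<forall>i\<in>C. \<not> Or w i)))"

definition P_matrix :: "nat \<Rightarrow> real mat \<Rightarrow> bool" where
  "P_matrix n M \<longleftrightarrow> M \<in> carrier_mat n n \<and>
     (\<forall>S. S \<subseteq> {..<n} \<longrightarrow> S \<noteq> {} \<longrightarrow> det (submatrix M S S) > 0)"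

definition Z_matrix :: "nat \<Rightarrow> real mat \<Rightarrow> bool" where
  "Z_matrix n M \<longleftrightarrow> M \<in> carrier_mat n n \<and>
     (\<forall>i<n. \<forall>j<n. i \<noteq> j \<longrightarrow> M $$ (i, j) \<le> 0)"

definition K_matrix :: "nat \<Rightarrow> real mat \<Rightarrow> bool" where
  "K_matrix n M \<longleftrightarrow> Z_matrix n M \<and> P_matrix n M"

definition A_mat :: "nat \<Rightarrow> real mat \<Rightarrow> nat set \<Rightarrow> real mat" where
  "A_mat n M B = mat n n (\<lambda>(i, j). if j \<in> B then - (M $$ (i, j)) else (if i = j then 1 else 0))"

text \<open>A_B^{-1} q, as the unique solution x of A_B x = q (A_B is invertible for P-matrices M).\<close>

definition lcp_sol :: "nat \<Rightarrow> real mat \<Rightarrow> real vec \<Rightarrow> nat set \<Rightarrow> real vec" where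
  "lcp_sol n M q B = (THE x. x \<in> carrier_vec n \<and> A_mat n M B *\<^sub>v x = q)"

definition nondegenerate :: "nat \<Rightarrow> real mat \<Rightarrow> real vec \<Rightarrow> bool" where
  "nondegenerate n M q \<longleftrightarrow> P_matrix n M \<and> q \<in> carrier_vec n \<and>
     (\<forall>B i. B \<subseteq> {..<n} \<longrightarrow> i < n \<longrightarrow> lcp_sol n M q B $ i \<noteq> 0)"

definition lcp_orientation :: "nat \<Rightarrow> real mat \<Rightarrow> real vec \<Rightarrow> nat set \<Rightarrow> nat \<Rightarrow> bool" where
  "lcp_orientation n M q = (\<lambda>v i. v \<subseteq> {..<n} \<and> i < n \<and> lcp_sol n M q v $ i < 0)"

definition K_USOs :: "nat \<Rightarrow> (nat set \<Rightarrow> nat \<Rightarrow> bool) set" where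
  "K_USOs n = {Or. is_USO n Or \<and>
     (\<exists>M q. K_matrix n M \<and> nondegenerate n M q \<and> Or = lcp_orientation n M q)}"

definition P_USOs :: "nat \<Rightarrow> (nat set \<Rightarrow> nat \<Rightarrow> bool) set" where
  "P_USOs n = {Or. is_USO n Or \<and>
     (\<exists>M q. P_matrix n M \<and> nondegenerate n M q \<and> Or = lcp_orientation n M q)}"

end

(*
Upper bound. An orientation is determined by the signs of at most n 2^n polynomials of degree 2n in
the n^2 + n entries of (M, q), so it suffices that s nowhere vanishing polynomials of degree d in k
variables have at most (2sd + 1)^k sign patterns. Let f be the product of the polynomials and
G = f^2 - e (x_1^N + ... + x_k^N) with N = 2sd + 2 and e > 0 small. Then G is positive somewhere in
every cell, nonpositive on the boundaries and far out, hence has a critical point in every cell. The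
critical points satisfy equations x_i^(N-1) = g_i(x) with deg g_i < N - 1, so on the set of critical
points all functions are combinations of monomials with exponents below N - 1; there are
(N - 1)^k of those.

Lower bound. Take three blocks X, Y, Z of m = n div 3 coordinates and M = I - N with N >= 0 strictly
upper triangular, N_jk = 2^k for j in Y, k in Z and N_ij = 1 / t_ij for i in X, j in Y. For B
consisting of one j in Y and the binary digits (in Z) of a number s < 2^m, the i-th coordinate of
the solution is about 1 - (1 + s) / t_ij. So every threshold t_ij in {1..2^m} can be read off the
orientation, which makes (2^m)^(m^2) orientations.
*)

theory Submission
  imports Defs "HOL-Analysis.Function_Topology" "HOL-Library.Function_Algebras" "HOL-Library.Nat_Bijection"
begin

section \<open>Sign patterns of polynomials\<close>

text \<open>Polynomials are taken as functions and built one monomial at a time, so that facts about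
  them follow by induction on the terms. The number \<open>d\<close> is a bound on the total degree
  in the variables from \<open>I\<close>, not the degree itself.\<close>

inductive poly_fun :: "'i set \<Rightarrow> nat \<Rightarrow> (('i \<Rightarrow> real) \<Rightarrow> real) \<Rightarrow> bool" for I d where
  zero: "poly_fun I d (\<lambda>x. 0)"
| add: "poly_fun I d f \<Longrightarrow> sum e I \<le> d \<Longrightarrow> poly_fun I d (\<lambda>x. c * (\<Prod>i\<in>I. x i ^ e i) + f x)"

lemma poly_fun_monomial:
  assumes "sum e I \<le> d"
  shows "poly_fun I d (\<lambda>x. c * (\<Prod>i\<in>I. x i ^ e i))"
  using poly_fun.add[OF poly_fun.zero assms, of c] by simp

lemma poly_fun_add:
  assumes "poly_fun I d f" "poly_fun I d g"
  shows "poly_fun I d (\<lambda>x. f x + g x)"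
  using assms
proof (induction rule: poly_fun.induct)
  case (add f e c)
  have "poly_fun I d (\<lambda>x. c * (\<Prod>i\<in>I. x i ^ e i) + (f x + g x))"
    using add by (intro poly_fun.add) auto
  then show ?case by (simp add: add.assoc)
qed simp

lemma poly_fun_monomial_mult:
  assumes "poly_fun I b g" "sum e I \<le> a"
  shows "poly_fun I (a + b) (\<lambda>x. c * (\<Prod>i\<in>I. x i ^ e i) * g x)"
  using assms
proof (induction rule: poly_fun.induct)
  case zero
  then show ?case by (simp add: poly_fun.zero)
next
  case (add f e' c')
  have "poly_fun I (a + b) (\<lambda>x. (c * c') * (\<Prod>i\<in>I. x i ^ (e i + e' i)) + c * (\<Prod>i\<in>I. x i ^ e i) * f x)"
    using add by (intro poly_fun.add) (auto simp: sum.distrib)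
  then show ?case by (simp add: algebra_simps power_add prod.distrib)
qed

lemma poly_fun_mult:
  assumes "poly_fun I a f" "poly_fun I b g"
  shows "poly_fun I (a + b) (\<lambda>x. f x * g x)"
  using assms
proof (induction rule: poly_fun.induct)
  case zero
  then show ?case by (simp add: poly_fun.zero)
next
  case (add f e c)
  show ?case
    using poly_fun_add[OF poly_fun_monomial_mult[OF \<open>poly_fun I b g\<close> add.hyps(2), of c] add.IH[OF add.prems]]
    by (simp add: algebra_simps)
qed

lemma poly_fun_const: "poly_fun I d (\<lambda>x. c)"
  using poly_fun_monomial[of "\<lambda>i. 0" I d c] by simp

lemma poly_fun_var:
  assumes "finite I" "i \<in> I"
  shows "poly_fun I 1 (\<lambda>x. x i)"
proof -
  have "(\<Prod>j\<in>I. x j ^ (if j = i then 1 else 0)) = x i" for x :: "_ \<Rightarrow> real"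
    using assms by (simp add: if_distrib[of "\<lambda>e. _ ^ e"] prod.delta cong: if_cong)
  moreover have "sum (\<lambda>j. if j = i then 1 else 0::nat) I \<le> 1"
    using assms by simp
  ultimately show ?thesis
    using poly_fun_monomial[of "\<lambda>j. if j = i then 1 else 0" I 1 1] by simp
qed

lemma poly_fun_cmult: "poly_fun I d f \<Longrightarrow> poly_fun I d (\<lambda>x. c * f x)"
  using poly_fun_mult[OF poly_fun_const[of I 0 c], of d f] by simp

lemma poly_fun_diff:
  assumes "poly_fun I d f" "poly_fun I d g"
  shows "poly_fun I d (\<lambda>x. f x - g x)"
  using poly_fun_add[OF assms(1) poly_fun_cmult[OF assms(2), of "-1"]] by simp

lemma poly_fun_sum:
  assumes "\<And>a. a \<in> A \<Longrightarrow> poly_fun I d (f a)"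
  shows "poly_fun I d (\<lambda>x. \<Sum>a\<in>A. f a x)"
  using assms
  by (induction A rule: infinite_finite_induct) (auto intro: poly_fun.zero poly_fun_add)

lemma poly_fun_prod:
  assumes "\<And>a. a \<in> A \<Longrightarrow> poly_fun I d (f a)"
  shows "poly_fun I (card A * d) (\<lambda>x. \<Prod>a\<in>A. f a x)"
  using assms
  by (induction A rule: infinite_finite_induct) (auto intro: poly_fun_const poly_fun_mult)

lemma poly_fun_cong:
  assumes "poly_fun I d f" "\<And>i. i \<in> I \<Longrightarrow> x i = y i"
  shows "f x = f y"
  using assms by (induction rule: poly_fun.induct) auto

lemma poly_fun_continuous:
  assumes "poly_fun I d f"
  shows "continuous_on UNIV f"
  using assms
  by (induction rule: poly_fun.induct) (auto intro!: continuous_intros continuous_on_product_coordinates)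

text \<open>Where the coordinates in \<open>I\<close> are at most \<open>r\<close> in absolute
  value, with \<open>r >= 1\<close>, every monomial of degree at most \<open>d\<close> is bounded by
  \<open>r ^ d\<close>. Hence the sum of the absolute values of the coefficients serves as
  \<open>C\<close>.\<close>

lemma poly_fun_growth:
  assumes "poly_fun I d f"
  obtains C where "C \<ge> 0" "\<And>x r. r \<ge> 1 \<Longrightarrow> (\<And>i. i \<in> I \<Longrightarrow> \<bar>x i\<bar> \<le> r) \<Longrightarrow> \<bar>f x\<bar> \<le> C * r ^ d"
proof -
  have "\<exists>C\<ge>0. \<forall>x r. r \<ge> 1 \<longrightarrow> (\<forall>i\<in>I. \<bar>x i\<bar> \<le> r) \<longrightarrow> \<bar>f x\<bar> \<le> C * r ^ d"
    using assms
  proof (induction rule: poly_fun.induct)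
    case zero
    show ?case by (auto intro: exI[of _ 0])
  next
    case (add f e c)
    then obtain C where C: "C \<ge> 0" "\<And>x r. r \<ge> 1 \<Longrightarrow> (\<forall>i\<in>I. \<bar>x i\<bar> \<le> r) \<Longrightarrow> \<bar>f x\<bar> \<le> C * r ^ d"
      by blast
    have "\<bar>c * (\<Prod>i\<in>I. x i ^ e i) + f x\<bar> \<le> (\<bar>c\<bar> + C) * r ^ d"
      if r: "r \<ge> 1" "\<forall>i\<in>I. \<bar>x i\<bar> \<le> r" for x r
    proof -
      have "\<bar>\<Prod>i\<in>I. x i ^ e i\<bar> = (\<Prod>i\<in>I. \<bar>x i\<bar> ^ e i)"
        by (simp add: abs_prod power_abs)
      also have "\<dots> \<le> (\<Prod>i\<in>I. r ^ e i)"
        using r by (intro prod_mono) (auto intro: power_mono)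
      also have "\<dots> = r ^ sum e I" by (simp add: power_sum)
      also have "\<dots> \<le> r ^ d" using r add.hyps by (intro power_increasing) auto
      finally have "\<bar>c * (\<Prod>i\<in>I. x i ^ e i)\<bar> \<le> \<bar>c\<bar> * r ^ d"
        by (simp add: abs_mult mult_left_mono)
      with C(2)[OF r] show ?thesis by (simp add: algebra_simps)
    qed
    then show ?case using C(1) by (intro exI[of _ "\<bar>c\<bar> + C"]) auto
  qed
  then show ?thesis using that by blast
qed

lemma poly_fun_deriv:
  assumes "poly_fun I d f" "finite I" "i \<in> I"
  obtains f' where "poly_fun I d f'" "\<And>x. ((\<lambda>t. f (x(i := t))) has_real_derivative f' x) (at (x i))"
proof -
  have "\<exists>f'. poly_fun I d f' \<and> (\<forall>x. ((\<lambda>t. f (x(i := t))) has_real_derivative f' x) (at (x i)))"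
    using assms(1)
  proof (induction rule: poly_fun.induct)
    case zero
    show ?case by (intro exI[of _ "\<lambda>x. 0"]) (auto intro: poly_fun.zero)
  next
    case (add f e c)
    then obtain f' where f': "poly_fun I d f'"
      "\<And>x. ((\<lambda>t. f (x(i := t))) has_real_derivative f' x) (at (x i))" by blast
    \<comment> \<open>For \<open>e i = 0\<close> truncated subtraction leaves the exponent 0, which
      is harmless because the coefficient \<open>c * e i\<close> of the derivative then
      vanishes.\<close>
    define e' where "e' = e(i := e i - 1)"
    have split: "(\<Prod>j\<in>I. y j ^ a j) = y i ^ a i * (\<Prod>j\<in>I-{i}. y j ^ a j)"
      for y :: "_ \<Rightarrow> real" and a :: "_ \<Rightarrow> nat"
      using assms by (simp add: prod.remove)
    have "sum e' I \<le> sum e I" unfolding e'_def by (intro sum_mono) auto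
    then have "poly_fun I d (\<lambda>x. (c * e i) * (\<Prod>j\<in>I. x j ^ e' j) + f' x)"
      using f'(1) add.hyps(2) by (intro poly_fun.add) auto
    moreover have "((\<lambda>t. c * (\<Prod>j\<in>I. (x(i := t)) j ^ e j) + f (x(i := t))) has_real_derivative
        (c * e i) * (\<Prod>j\<in>I. x j ^ e' j) + f' x) (at (x i))" for x
    proof -
      have "(\<Prod>j\<in>I-{i}. (x(i := t)) j ^ e j) = (\<Prod>j\<in>I-{i}. x j ^ e' j)" for t
        by (intro prod.cong) (auto simp: e'_def)
      then show ?thesis unfolding split
        by (auto intro!: derivative_eq_intros f'(2) simp: e'_def)
    qed
    ultimately show ?case by blast
  qed
  then show ?thesis using that by blast
qed

lemma poly_fun_isCont:
  assumes "poly_fun I d f" "finite I" "i \<in> I"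
  shows "isCont (\<lambda>t. f (x(i := t))) (x i)"
proof -
  obtain f' where "((\<lambda>t. f (x(i := t))) has_real_derivative f' x) (at (x i))"
    using poly_fun_deriv[OF assms] by metis
  then show ?thesis by (rule DERIV_isCont)
qed

section \<open>Counting the solutions of a power system by linear independence\<close>

interpretation real_fun: vector_space "\<lambda>(c::real) (f::'a \<Rightarrow> real) x. c * f x"
  by unfold_locales (auto simp: fun_eq_iff algebra_simps)

text \<open>Indicators of distinct points are linearly independent, and an independent set in the
  span of \<open>R\<close> has at most \<open>card R\<close> elements. Counting points thus becomes
  bounding a dimension.\<close>

lemma card_le_card_span_indicators:
  fixes R :: "('a \<Rightarrow> real) set"
  assumes "finite R" "\<And>p. p \<in> X \<Longrightarrow> (\<lambda>x. if x = p then 1 else 0) \<in> real_fun.span R"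
  shows "card X \<le> card R"
proof -
  define \<delta> :: "'a \<Rightarrow> 'a \<Rightarrow> real" where "\<delta> = (\<lambda>p x. if x = p then 1 else 0)"
  have inj: "inj_on \<delta> X"
    by (rule inj_onI) (metis \<delta>_def zero_neq_one)
  have "real_fun.independent (\<delta> ` X)"
    unfolding real_fun.dependent_explicit
  proof safe
    fix t u v assume t: "finite t" "t \<subseteq> \<delta> ` X" "v \<in> t" "u v \<noteq> 0"
      and sum0: "(\<Sum>v\<in>t. (\<lambda>x. u v * v x)) = 0"
    obtain p where p: "p \<in> X" "v = \<delta> p" using t by auto
    have sum_apply: "(\<Sum>v\<in>t. (\<lambda>x. u v * v x)) p = (\<Sum>v\<in>t. u v * v p)"
      using t(1) by (induction t) auto
    \<comment> \<open>Evaluation at \<open>p\<close> isolates the coefficient of \<open>v\<close> in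
      the vanishing combination.\<close>
    have "u w * w p = (if w = v then u v else 0)" if w: "w \<in> t" for w
    proof -
      obtain p' where "w = \<delta> p'" using w t(2) by auto
      then show ?thesis using p by (cases "p' = p") (auto simp: \<delta>_def dest: fun_cong[of _ _ p])
    qed
    then have "(\<Sum>v\<in>t. u v * v p) = u v" using t by simp
    with sum0 sum_apply t(4) show False by simp
  qed
  moreover have "\<delta> ` X \<subseteq> real_fun.span R"
    using assms(2) by (auto simp: \<delta>_def)
  ultimately have "card (\<delta> ` X) \<le> card R"
    using real_fun.independent_span_bound[OF assms(1)] by blast
  then show ?thesis using inj by (simp add: card_image)
qed

text \<open>Lagrange interpolation: every other point \<open>q\<close> differs from \<open>p\<close>
  in some coordinate, which lies in \<open>I\<close> because all points vanish outside
  \<open>I\<close>. The product takes one linear factor for each \<open>q\<close>, equal to 0 at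
  \<open>q\<close> and to 1 at \<open>p\<close>.\<close>

lemma poly_fun_indicator:
  assumes "finite X" "p \<in> X" "finite I" "\<forall>x\<in>X. \<forall>i. i \<notin> I \<longrightarrow> x i = 0"
  obtains d f where "poly_fun I d f" "\<And>x. x \<in> X \<Longrightarrow> f x = (if x = p then 1 else 0)"
proof -
  have "\<exists>i\<in>I. p i \<noteq> q i" if "q \<in> X - {p}" for q
    using that assms(2,4) by (metis DiffD1 DiffD2 ext singletonI)
  then obtain c where c: "\<And>q. q \<in> X - {p} \<Longrightarrow> c q \<in> I \<and> p (c q) \<noteq> q (c q)" by metis
  define f where "f = (\<lambda>x. \<Prod>q\<in>X-{p}. 1 / (p (c q) - q (c q)) * (x (c q) - q (c q)))"
  have "poly_fun I (card (X - {p}) * 1) f" unfolding f_def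
    using c assms by (intro poly_fun_prod poly_fun_cmult poly_fun_diff poly_fun_const poly_fun_var) auto
  moreover have "f x = (if x = p then 1 else 0)" if "x \<in> X" for x
    unfolding f_def using that assms(1) c by (auto simp: prod_zero_iff)
  ultimately show ?thesis using that by blast
qed

text \<open>The equations \<open>x\<^sub>i\<^sup>m = g\<^sub>i(x)\<close> rewrite every polynomial on \<open>X\<close> into
  monomials with exponents below \<open>m\<close>, and polynomials separate the points of \<open>X\<close>.\<close>

lemma card_power_system_le:
  fixes X :: "('i \<Rightarrow> real) set"
  assumes fin: "finite I" "finite X"
    and supp: "\<And>x i. x \<in> X \<Longrightarrow> i \<notin> I \<Longrightarrow> x i = 0"
    and g: "\<And>i. i \<in> I \<Longrightarrow> poly_fun I d (g i)" "d < m"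
    and sol: "\<And>x i. x \<in> X \<Longrightarrow> i \<in> I \<Longrightarrow> x i ^ m = g i x"
  shows "card X \<le> m ^ card I"
proof -
  define E where "E = (PiE I (\<lambda>_. {..<m}) :: ('i \<Rightarrow> nat) set)"
  \<comment> \<open>Cutting functions off outside \<open>X\<close> turns equality on
    \<open>X\<close> into equality of functions, so the equations of the system become identities in
    the vector space.\<close>
  define res :: "(('i \<Rightarrow> real) \<Rightarrow> real) \<Rightarrow> ('i \<Rightarrow> real) \<Rightarrow> real"
    where "res = (\<lambda>f x. if x \<in> X then f x else 0)"
  define mon :: "('i \<Rightarrow> nat) \<Rightarrow> ('i \<Rightarrow> real) \<Rightarrow> real"
    where "mon = (\<lambda>e x. \<Prod>i\<in>I. x i ^ e i)"
  define R where "R = (\<lambda>e. res (mon e)) ` E"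
  have finE: "finite E" and cardE: "card E = m ^ card I"
    unfolding E_def using fin by (auto simp: card_PiE intro: finite_PiE)
  have span_poly: "res f \<in> real_fun.span R"
    if "poly_fun I k f" "\<And>e. sum e I \<le> k \<Longrightarrow> res (mon e) \<in> real_fun.span R" for k f
    using that
  proof (induction rule: poly_fun.induct)
    case zero
    show ?case using real_fun.span_zero[of R] by (simp add: res_def zero_fun_def)
  next
    case (add f e c)
    have "res (\<lambda>x. c * (\<Prod>i\<in>I. x i ^ e i) + f x) = (\<lambda>x. c * res (mon e) x) + res f"
      by (auto simp: res_def mon_def)
    moreover have "res (mon e) \<in> real_fun.span R" "res f \<in> real_fun.span R" using add by auto
    ultimately show ?case
      using real_fun.span_add[OF real_fun.span_scale[of "res (mon e)" R c], of "res f"] by presburger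
  qed
  \<comment> \<open>Induction on the total degree: as \<open>d < m\<close>, replacing a factor
    \<open>x i ^ m\<close> by \<open>g i x\<close> lowers the degree.\<close>
  have span_mon: "res (mon e) \<in> real_fun.span R" for e
  proof (induction "sum e I" arbitrary: e rule: less_induct)
    case less
    show ?case
    proof (cases "\<forall>i\<in>I. e i < m")
      case True
      then have "restrict e I \<in> E" by (auto simp: E_def)
      moreover have "mon e = mon (restrict e I)" by (auto simp: mon_def)
      ultimately show ?thesis by (auto simp: R_def intro: real_fun.span_base)
    next
      case False
      then obtain i where i: "i \<in> I" "e i \<ge> m" by (auto simp: not_less)
      define e' where "e' = e(i := e i - m)"
      have split: "sum a I = a i + sum a (I-{i})" "mon a x = x i ^ a i * (\<Prod>j\<in>I-{i}. x j ^ a j)" for a x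
        unfolding mon_def using fin i by (auto simp: sum.remove prod.remove)
      have "sum e I = m + sum e' I" unfolding split using i
        by (auto simp: e'_def intro: sum.cong)
      moreover have "res (mon e) = res (\<lambda>x. mon e' x * g i x)"
      proof -
        have "mon e x = mon e' x * g i x" if "x \<in> X" for x
        proof -
          have "mon e x = x i ^ m * (x i ^ (e i - m) * (\<Prod>j\<in>I-{i}. x j ^ e j))"
            unfolding split(2) using i(2) by (simp flip: power_add)
          also have "(x i ^ (e i - m) * (\<Prod>j\<in>I-{i}. x j ^ e j)) = mon e' x"
            unfolding split(2) by (auto simp: e'_def intro!: prod.cong)
          finally show ?thesis using sol[OF that i(1)] by simp
        qed
        then show ?thesis by (auto simp: res_def)
      qed
      moreover have "poly_fun I (sum e' I + d) (\<lambda>x. mon e' x * g i x)"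
        using poly_fun_monomial_mult[OF g(1)[OF i(1)], of e' "sum e' I" 1] by (simp add: mon_def)
      ultimately show ?thesis using less g(2) span_poly by auto
    qed
  qed
  have "(\<lambda>x. if x = p then 1 else 0) \<in> real_fun.span R" if p: "p \<in> X" for p
  proof -
    obtain k f where f: "poly_fun I k f" "\<And>x. x \<in> X \<Longrightarrow> f x = (if x = p then 1 else 0)"
      using poly_fun_indicator[OF fin(2) p fin(1)] supp by blast
    then have "res f = (\<lambda>x. if x = p then 1 else 0)" using p by (auto simp: res_def)
    then show ?thesis using span_poly[OF f(1)] span_mon by metis
  qed
  then have "card X \<le> card R"
    using finE by (intro card_le_card_span_indicators) (auto simp: R_def)
  also have "\<dots> \<le> m ^ card I" unfolding R_def using card_image_le[OF finE] cardE by metis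
  finally show ?thesis .
qed


text \<open>Each pattern gets its own maximiser of \<open>G\<close> over a compact closed cell. The
  maximisers are critical points, so they solve equations of the form required by
  \<open>card_power_system_le\<close>, with exponent \<open>2 * D + 1\<close>.\<close>

lemma card_sign_patterns_le:
  fixes F :: "'j \<Rightarrow> ('i \<Rightarrow> real) \<Rightarrow> real"
  assumes fin: "finite I" "finite J" and F: "\<And>j. j \<in> J \<Longrightarrow> poly_fun I d (F j)"
  shows "card {{j\<in>J. F j x < 0} | x. \<forall>j\<in>J. F j x \<noteq> 0} \<le> (2 * (card J * d) + 1) ^ card I"
proof -
  define \<Sigma> where "\<Sigma> = {{j\<in>J. F j x < 0} | x. \<forall>j\<in>J. F j x \<noteq> 0}"
  define D where "D = card J * d"
  define f where "f = (\<lambda>x. \<Prod>j\<in>J. F j x)"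
  define g where "g = (\<lambda>x. f x * f x)"
  \<comment> \<open>The exponent is even, so \<open>S\<close> is nonnegative. It exceeds the degree
    \<open>2 * D\<close> of \<open>g\<close> by two, so that \<open>S\<close> dominates
    \<open>g\<close> far out and its partial derivatives still have larger degree than those of
    \<open>g\<close>.\<close>
  define S :: "('i \<Rightarrow> real) \<Rightarrow> real" where "S = (\<lambda>x. \<Sum>i\<in>I. x i ^ (2 * D + 2))"
  have "finite \<Sigma>" unfolding \<Sigma>_def using fin by (auto intro: finite_subset[of _ "Pow J"])
  have f: "poly_fun I D f" unfolding f_def D_def using F by (rule poly_fun_prod)
  have g: "poly_fun I (2 * D) g" unfolding g_def using poly_fun_mult[OF f f] by (simp add: mult_2)
  have f0: "f x \<noteq> 0 \<longleftrightarrow> (\<forall>j\<in>J. F j x \<noteq> 0)" for x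
    unfolding f_def using fin by auto

  \<comment> \<open>The functions \<open>F j\<close> depend only on the coordinates in
    \<open>I\<close>, so witnesses may be normalised to vanish elsewhere.\<close>
  have "\<exists>p. (\<forall>i. i \<notin> I \<longrightarrow> p i = 0) \<and> (\<forall>j\<in>J. F j p \<noteq> 0) \<and> \<sigma> = {j\<in>J. F j p < 0}"
    if \<sigma>: "\<sigma> \<in> \<Sigma>" for \<sigma>
  proof -
    obtain x where x: "\<forall>j\<in>J. F j x \<noteq> 0" "\<sigma> = {j\<in>J. F j x < 0}" using \<sigma> by (auto simp: \<Sigma>_def)
    have "F j (\<lambda>i. if i \<in> I then x i else 0) = F j x" if "j \<in> J" for j
      by (rule poly_fun_cong[OF F[OF that]]) auto
    then show ?thesis using x by (intro exI[of _ "\<lambda>i. if i \<in> I then x i else 0"]) auto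
  qed
  then obtain p where p: "\<And>\<sigma>. \<sigma> \<in> \<Sigma> \<Longrightarrow> (\<forall>i. i \<notin> I \<longrightarrow> p \<sigma> i = 0) \<and> (\<forall>j\<in>J. F j (p \<sigma>) \<noteq> 0) \<and> \<sigma> = {j\<in>J. F j (p \<sigma>) < 0}"
    by metis
  have gp: "g (p \<sigma>) > 0" if "\<sigma> \<in> \<Sigma>" for \<sigma>
    using p[OF that] f0[of "p \<sigma>"] by (auto simp: g_def zero_less_mult_iff)

  have "\<forall>\<^sub>F \<epsilon> in at_right 0. \<epsilon> * S (p \<sigma>) < g (p \<sigma>)" if "\<sigma> \<in> \<Sigma>" for \<sigma>
  proof -
    have "((\<lambda>\<epsilon>. \<epsilon> * S (p \<sigma>)) \<longlongrightarrow> 0 * S (p \<sigma>)) (at_right 0)" by (intro tendsto_intros)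
    then show ?thesis using gp[OF that] by (intro order_tendstoD(2)) auto
  qed
  then have "\<forall>\<^sub>F \<epsilon> in at_right 0. \<forall>\<sigma>\<in>\<Sigma>. \<epsilon> * S (p \<sigma>) < g (p \<sigma>)"
    using \<open>finite \<Sigma>\<close> by (intro eventually_ball_finite) auto
  with eventually_at_right_less have "\<forall>\<^sub>F \<epsilon> in at_right (0::real). \<epsilon> > 0 \<and> (\<forall>\<sigma>\<in>\<Sigma>. \<epsilon> * S (p \<sigma>) < g (p \<sigma>))"
    by (rule eventually_conj)
  \<comment> \<open>There are finitely many patterns, so one \<epsilon> is small enough for all
    their witnesses.\<close>
  then obtain \<epsilon> :: real where \<epsilon>: "\<epsilon> > 0" "\<And>\<sigma>. \<sigma> \<in> \<Sigma> \<Longrightarrow> \<epsilon> * S (p \<sigma>) < g (p \<sigma>)"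
    using eventually_happens'[OF trivial_limit_at_right_real] by blast
  define G where "G = (\<lambda>x. g x - \<epsilon> * S x)"
  have even_power: "0 \<le> t ^ (2 * D + 2)" for t :: real by (rule zero_le_even_power) simp
  have S0: "S x \<ge> 0" for x unfolding S_def by (intro sum_nonneg even_power)
  have Gf: "f x \<noteq> 0" if "G x > 0" for x
  proof
    assume "f x = 0"
    moreover have "\<epsilon> * S x \<ge> 0" using S0 \<epsilon>(1) by simp
    ultimately show False using that by (simp add: G_def g_def)
  qed
  have Gp: "G (p \<sigma>) > 0" if "\<sigma> \<in> \<Sigma>" for \<sigma> using \<epsilon>(2)[OF that] by (simp add: G_def)

  obtain C where C: "C \<ge> 0" "\<And>x r. r \<ge> 1 \<Longrightarrow> (\<And>i. i \<in> I \<Longrightarrow> \<bar>x i\<bar> \<le> r) \<Longrightarrow> \<bar>g x\<bar> \<le> C * r ^ (2 * D)"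
    using poly_fun_growth[OF g] by blast
  \<comment> \<open>If the largest \<open>\<bar>x i\<bar>\<close> is \<open>r > R\<close>, then
    \<open>C / \<epsilon> \<le> r \<le> r\<^sup>2\<close>. Hence \<open>g x\<close> is at most
    \<open>\<epsilon> * r ^ (2 * D + 2)\<close>, which is at most
    \<open>\<epsilon> * S x\<close>.\<close>
  define R where "R = 1 + C / \<epsilon>"
  have "R \<ge> 1" using C \<epsilon> by (simp add: R_def)
  have far: "G x \<le> 0" if x: "i \<in> I" "\<bar>x i\<bar> > R" for x i
  proof -
    define r where "r = Max ((\<lambda>i. \<bar>x i\<bar>) ` I)"
    have "r \<ge> \<bar>x i\<bar>" if "i \<in> I" for i unfolding r_def using fin that by (intro Max_ge) auto
    moreover from this[OF x(1)] have r: "r > R" using x(2) by simp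
    ultimately have "\<bar>g x\<bar> \<le> C * r ^ (2 * D)" using \<open>R \<ge> 1\<close> by (intro C(2)) auto
    moreover have "C * r ^ (2 * D) \<le> (\<epsilon> * r\<^sup>2) * r ^ (2 * D)"
    proof (rule mult_right_mono)
      have "C / \<epsilon> \<le> r" using r by (simp add: R_def)
      also have "r \<le> r\<^sup>2" using r \<open>R \<ge> 1\<close> by (simp add: self_le_power)
      finally show "C \<le> \<epsilon> * r\<^sup>2" using \<epsilon>(1) by (simp add: field_simps)
    qed simp
    moreover have "r ^ (2 * D + 2) \<le> S x"
    proof -
      have "r \<in> (\<lambda>i. \<bar>x i\<bar>) ` I" unfolding r_def using fin x(1) by (intro Max_in) auto
      then obtain k where k: "k \<in> I" "r = \<bar>x k\<bar>" by auto
      have "r ^ (2 * D + 2) = x k ^ (2 * D + 2)" using k by (simp add: power_even_abs)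
      also have "\<dots> \<le> S x" unfolding S_def
        by (rule member_le_sum[OF k(1) even_power fin(1)])
      finally show ?thesis .
    qed
    then have "\<epsilon> * (r ^ (2 * D + 2)) \<le> \<epsilon> * S x" using \<epsilon>(1) by (intro mult_left_mono) auto
    moreover have "\<epsilon> * (r ^ (2 * D + 2)) = (\<epsilon> * r\<^sup>2) * r ^ (2 * D)"
      by (simp add: power_add power2_eq_square)
    ultimately show ?thesis unfolding G_def by linarith
  qed

  \<comment> \<open>The factors \<open>{0}\<close> outside \<open>I\<close> make the box a product
    of compact sets over the whole index type, so Tychonoff's theorem applies.\<close>
  define B where "B = (PiE UNIV (\<lambda>i. if i \<in> I then {-R..R} else {0}) :: ('i \<Rightarrow> real) set)"
  have memB: "x \<in> B \<longleftrightarrow> (\<forall>i\<in>I. \<bar>x i\<bar> \<le> R) \<and> (\<forall>i. i \<notin> I \<longrightarrow> x i = 0)" for x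
  proof -
    have "x i \<in> (if i \<in> I then {-R..R} else {0}) \<longleftrightarrow> (i \<in> I \<longrightarrow> \<bar>x i\<bar> \<le> R) \<and> (i \<notin> I \<longrightarrow> x i = 0)" for i
      by (simp add: abs_le_iff) linarith
    then show ?thesis unfolding B_def PiE_UNIV_domain Pi_iff by auto
  qed
  have "compactin (product_topology (\<lambda>i. euclidean) UNIV) B"
    unfolding B_def compactin_PiE by auto
  then have "compact B" unfolding euclidean_product_topology by simp
  \<comment> \<open>Weak inequalities keep the cell closed, so that a maximum exists; strictness is
    regained afterwards.\<close>
  define K where "K = (\<lambda>\<sigma>. B \<inter> (\<Inter>j\<in>J. {x. if j \<in> \<sigma> then F j x \<le> 0 else 0 \<le> F j x}))"
  have compK: "compact (K \<sigma>)" for \<sigma>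
  proof -
    have "closed {x. if j \<in> \<sigma> then F j x \<le> 0 else 0 \<le> F j x}" if "j \<in> J" for j
      using poly_fun_continuous[OF F[OF that]]
      by (cases "j \<in> \<sigma>") (auto intro!: closed_Collect_le continuous_on_const)
    then show ?thesis unfolding K_def using \<open>compact B\<close> by (intro compact_Int_closed closed_INT) auto
  qed
  have contG: "continuous_on A G" for A
  proof -
    have "continuous_on UNIV G" unfolding G_def S_def
      by (intro continuous_intros poly_fun_continuous[OF g] continuous_on_product_coordinates)
    then show ?thesis using continuous_on_subset by blast
  qed
  have pK: "p \<sigma> \<in> K \<sigma>" if "\<sigma> \<in> \<Sigma>" for \<sigma>
  proof -
    have "p \<sigma> \<in> B" unfolding memB using p[OF that] far[of _ "p \<sigma>"] Gp[OF that] by (meson not_less)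
    moreover have "if j \<in> \<sigma> then F j (p \<sigma>) \<le> 0 else 0 \<le> F j (p \<sigma>)" if "j \<in> J" for j
    proof -
      have "j \<in> \<sigma> \<longleftrightarrow> F j (p \<sigma>) < 0" using p[OF \<open>\<sigma> \<in> \<Sigma>\<close>] that by blast
      then show ?thesis by simp
    qed
    ultimately show ?thesis by (simp add: K_def)
  qed
  have "\<exists>y\<in>K \<sigma>. \<forall>x\<in>K \<sigma>. G x \<le> G y" if "\<sigma> \<in> \<Sigma>" for \<sigma>
    using pK[OF that] by (intro continuous_attains_sup compK contG) auto
  then obtain y where y: "\<And>\<sigma>. \<sigma> \<in> \<Sigma> \<Longrightarrow> y \<sigma> \<in> K \<sigma> \<and> (\<forall>x\<in>K \<sigma>. G x \<le> G (y \<sigma>))"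
    using bchoice[of \<Sigma> "\<lambda>\<sigma> z. z \<in> K \<sigma> \<and> (\<forall>x\<in>K \<sigma>. G x \<le> G z)"] by blast
  have Gy: "G (y \<sigma>) > 0" if "\<sigma> \<in> \<Sigma>" for \<sigma> using y[OF that] pK[OF that] Gp[OF that] by force
  \<comment> \<open>The maximum of \<open>G\<close> is positive because the cell contains
    \<open>p \<sigma>\<close>. As \<open>G\<close> is positive only where \<open>f\<close> does not
    vanish, the maximiser avoids the boundary of its cell.\<close>
  have sgn_y: "if j \<in> \<sigma> then F j (y \<sigma>) < 0 else 0 < F j (y \<sigma>)" if "\<sigma> \<in> \<Sigma>" "j \<in> J" for \<sigma> j
  proof -
    have "F j (y \<sigma>) \<noteq> 0" using Gf[OF Gy[OF that(1)]] f0 that(2) by blast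
    moreover have "if j \<in> \<sigma> then F j (y \<sigma>) \<le> 0 else 0 \<le> F j (y \<sigma>)"
      using y[OF that(1)] that(2) by (auto simp: K_def)
    ultimately show ?thesis by (auto split: if_splits)
  qed
  have inj: "inj_on y \<Sigma>"
  proof (rule inj_onI)
    fix \<sigma> \<tau> assume st: "\<sigma> \<in> \<Sigma>" "\<tau> \<in> \<Sigma>" "y \<sigma> = y \<tau>"
    have "\<sigma> = {j\<in>J. F j (y \<sigma>) < 0}" if "\<sigma> \<in> \<Sigma>" for \<sigma>
    proof -
      have "\<sigma> \<subseteq> J" using that by (auto simp: \<Sigma>_def)
      then show ?thesis using sgn_y[OF that] by (force split: if_splits)
    qed
    then show "\<sigma> = \<tau>" using st by metis
  qed

  have "\<exists>h. poly_fun I (2 * D) h \<and> (\<forall>x. ((\<lambda>t. g (x(i := t))) has_real_derivative h x) (at (x i)))"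
    if "i \<in> I" for i
    using poly_fun_deriv[OF g fin(1) that] by metis
  then obtain h where h: "\<And>i. i \<in> I \<Longrightarrow> poly_fun I (2 * D) (h i)"
    "\<And>i x. i \<in> I \<Longrightarrow> ((\<lambda>t. g (x(i := t))) has_real_derivative h i x) (at (x i))"
    by metis
  have derivG: "((\<lambda>t. G (x(i := t))) has_real_derivative h i x - \<epsilon> * ((2 * D + 2) * x i ^ (2 * D + 1))) (at (x i))"
    if "i \<in> I" for i and x :: "'i \<Rightarrow> real"
  proof -
    have "S (x(i := t)) = t ^ (2 * D + 2) + (\<Sum>k\<in>I-{i}. x k ^ (2 * D + 2))" for t
      unfolding S_def using fin(1) that by (simp add: sum.remove)
    moreover have "((\<lambda>t. t ^ (2 * D + 2) + c) has_real_derivative (2 * D + 2) * x i ^ (2 * D + 1)) (at (x i))" for c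
      using DERIV_add[OF DERIV_pow[of "2 * D + 2"] DERIV_const[of c]] by (simp del: power_Suc)
    ultimately have "((\<lambda>t. S (x(i := t))) has_real_derivative (2 * D + 2) * x i ^ (2 * D + 1)) (at (x i))"
      by presburger
    then show ?thesis unfolding G_def by (intro DERIV_diff DERIV_cmult h that)
  qed
  \<comment> \<open>A small move along coordinate \<open>i\<close> preserves all strict signs. The
    moved point is either in the box, hence in the cell where \<open>y \<sigma>\<close> is maximal,
    or outside the box, where \<open>G\<close> is nonpositive. Thus \<open>y \<sigma>\<close> is a
    local maximum on this line.\<close>
  have crit: "h i (y \<sigma>) - \<epsilon> * ((2 * D + 2) * y \<sigma> i ^ (2 * D + 1)) = 0" if "\<sigma> \<in> \<Sigma>" "i \<in> I" for \<sigma> i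
  proof -
    have "\<forall>\<^sub>F t in nhds (y \<sigma> i). if j \<in> \<sigma> then F j ((y \<sigma>)(i := t)) < 0 else 0 < F j ((y \<sigma>)(i := t))"
      if "j \<in> J" for j
    proof -
      have "isCont (\<lambda>t. F j ((y \<sigma>)(i := t))) (y \<sigma> i)"
        by (rule poly_fun_isCont[OF F[OF that] fin(1) \<open>i \<in> I\<close>])
      then have "((\<lambda>t. F j ((y \<sigma>)(i := t))) \<longlongrightarrow> F j (y \<sigma>)) (nhds (y \<sigma> i))"
        using tendsto_at_iff_tendsto_nhds[of "\<lambda>t. F j ((y \<sigma>)(i := t))" "y \<sigma> i"]
        unfolding isCont_def by simp
      note lim = order_tendstoD[OF this]
      show ?thesis
      proof (cases "j \<in> \<sigma>")
        case True
        with lim(2)[of 0] sgn_y[OF \<open>\<sigma> \<in> \<Sigma>\<close> \<open>j \<in> J\<close>] show ?thesis by simp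
      next
        case False
        with lim(1)[of 0] sgn_y[OF \<open>\<sigma> \<in> \<Sigma>\<close> \<open>j \<in> J\<close>] show ?thesis by simp
      qed
    qed
    then have "\<forall>\<^sub>F t in nhds (y \<sigma> i). \<forall>j\<in>J. if j \<in> \<sigma> then F j ((y \<sigma>)(i := t)) < 0 else 0 < F j ((y \<sigma>)(i := t))"
      using fin(2) by (intro eventually_ball_finite) auto
    then obtain \<delta> where \<delta>: "\<delta> > 0"
      "\<forall>t. dist t (y \<sigma> i) < \<delta> \<longrightarrow> (\<forall>j\<in>J. if j \<in> \<sigma> then F j ((y \<sigma>)(i := t)) < 0 else 0 < F j ((y \<sigma>)(i := t)))"
      unfolding eventually_nhds_metric by meson
    have "G ((y \<sigma>)(i := t)) \<le> G ((y \<sigma>)(i := y \<sigma> i))" if "\<bar>y \<sigma> i - t\<bar> < \<delta>" for t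
    proof (cases "(y \<sigma>)(i := t) \<in> B")
      case True
      have "dist t (y \<sigma> i) < \<delta>" using that by (simp add: dist_real_def abs_minus_commute)
      then have "if j \<in> \<sigma> then F j ((y \<sigma>)(i := t)) \<le> 0 else 0 \<le> F j ((y \<sigma>)(i := t))" if "j \<in> J" for j
        using \<delta>(2) that by (meson less_imp_le)
      with True have "(y \<sigma>)(i := t) \<in> K \<sigma>" by (simp add: K_def)
      then show ?thesis using y[OF \<open>\<sigma> \<in> \<Sigma>\<close>] by simp
    next
      case False
      have "y \<sigma> \<in> B" using y[OF \<open>\<sigma> \<in> \<Sigma>\<close>] by (simp add: K_def)
      then have "\<forall>k. k \<notin> I \<longrightarrow> ((y \<sigma>)(i := t)) k = 0" using \<open>i \<in> I\<close> by (auto simp: memB)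
      with False obtain k where k: "k \<in> I" "\<bar>((y \<sigma>)(i := t)) k\<bar> > R"
        unfolding memB by (meson not_le)
      have "G ((y \<sigma>)(i := t)) \<le> 0" using far[of k "(y \<sigma>)(i := t)"] k by blast
      then show ?thesis using Gy[OF \<open>\<sigma> \<in> \<Sigma>\<close>] by simp
    qed
    then show ?thesis
      by (intro DERIV_local_max[OF derivG[OF \<open>i \<in> I\<close>, of "y \<sigma>"] \<delta>(1)]) blast
  qed

  \<comment> \<open>Dividing the critical point equation by \<open>\<epsilon> * (2 * D + 2)\<close>
    isolates the pure power \<open>x i ^ (2 * D + 1)\<close>.\<close>
  have "card (y ` \<Sigma>) \<le> (2 * D + 1) ^ card I"
  proof (rule card_power_system_le[where g = "\<lambda>i x. 1 / (\<epsilon> * (2 * D + 2)) * h i x" and d = "2 * D"])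
    fix x i assume "x \<in> y ` \<Sigma>" "i \<in> I"
    then obtain \<sigma> where \<sigma>: "\<sigma> \<in> \<Sigma>" "x = y \<sigma>" by auto
    have "\<epsilon> * (2 * real D + 2) > 0" using \<epsilon>(1) by (intro mult_pos_pos) auto
    then show "x i ^ (2 * D + 1) = 1 / (\<epsilon> * (2 * D + 2)) * h i x"
      using crit[OF \<sigma>(1) \<open>i \<in> I\<close>] \<sigma>(2) by (simp add: field_simps)
  next
    fix x i assume "x \<in> y ` \<Sigma>" "i \<notin> I"
    then show "x i = 0" using y memB by (auto simp: K_def)
  next
    fix i assume "i \<in> I"
    then show "poly_fun I (2 * D) (\<lambda>x. 1 / (\<epsilon> * (2 * D + 2)) * h i x)"
      by (intro poly_fun_cmult h(1))
  qed (use fin \<open>finite \<Sigma>\<close> in simp_all)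
  then show ?thesis unfolding card_image[OF inj] unfolding \<Sigma>_def D_def .
qed

section \<open>P-matrices and unique-sink orientations\<close>

lemma det_add_diagonal_entry:
  fixes A :: "'a :: comm_ring_1 mat"
  assumes A: "A \<in> carrier_mat n n" and a: "a < n"
  shows "det (mat n n (\<lambda>(i, j). A $$ (i, j) + (if i = a \<and> j = a then d else 0))) =
    det A + d * det (mat_delete A a a)"
proof -
  define A' where "A' = mat n n (\<lambda>(i, j). A $$ (i, j) + (if i = a \<and> j = a then d else 0))"
  have A': "A' \<in> carrier_mat n n" by (simp add: A'_def)
  \<comment> \<open>The two matrices differ only in row \<open>a\<close>, which the cofactors along
    that row omit.\<close>
  have "mat_delete A' a j = mat_delete A a j" for j
    using A by (auto simp: mat_delete_def A'_def)
  then have cof: "cofactor A' a j = cofactor A a j" for j by (simp add: cofactor_def)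
  have "det A' = (\<Sum>j<n. A' $$ (a, j) * cofactor A' a j)" by (rule laplace_expansion_row[OF A' a])
  also have "\<dots> = (\<Sum>j<n. A $$ (a, j) * cofactor A a j + (if j = a then d * cofactor A a a else 0))"
    unfolding cof using a by (intro sum.cong) (auto simp: A'_def algebra_simps)
  also have "\<dots> = det A + d * cofactor A a a"
    using a by (simp add: sum.distrib laplace_expansion_row[OF A a])
  finally show ?thesis by (simp add: A'_def cofactor_def flip: mult_2)
qed

lemma submatrix_principal:
  assumes "M \<in> carrier_mat n n" "S \<subseteq> {..<n}"
  shows "submatrix M S S = mat (card S) (card S) (\<lambda>(a, b). M $$ (pick S a, pick S b))"
proof -
  have "{i. i < n \<and> i \<in> S} = S" using assms(2) by auto
  then show ?thesis unfolding submatrix_def using assms(1) by simp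
qed

lemma pick_inj:
  assumes "a < card S" "b < card S" "pick S a = pick S b"
  shows "a = b"
  using assms pick_mono by (metis less_irrefl linorder_neqE_nat)

lemma bij_betw_pick:
  assumes "finite S"
  shows "bij_betw (pick S) {..<card S} S"
proof -
  have "inj_on (pick S) {..<card S}" by (auto intro: inj_onI pick_inj)
  moreover have "pick S ` {..<card S} \<subseteq> S" using pick_in_set by auto
  ultimately show ?thesis using assms
    by (simp add: bij_betw_def card_image card_subset_eq)
qed

text \<open>An element of a set is determined by the number of smaller elements in it, and removing
  \<open>pick S a\<close> lowers this number by one exactly for the larger elements. This is the
  index shift made by \<open>mat_delete\<close>.\<close>

lemma pick_remove:
  assumes "finite S" "a < card S" "b < card S - 1"
  shows "pick (S - {pick S a}) b = pick S (if b < a then b else Suc b)"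
proof -
  define b' where "b' = (if b < a then b else Suc b)"
  have b': "b' < card S" "b' \<noteq> a" using assms by (auto simp: b'_def)
  define p where "p = pick S b'"
  have p: "p \<in> S - {pick S a}" using b' assms pick_in_set pick_inj by (auto simp: p_def)
  have card_p: "card {x\<in>S. x < p} = b'" using b' by (simp add: p_def card_pick)
  have "card {x \<in> S - {pick S a}. x < p} = b"
  proof (cases "b < a")
    case True
    then have "p < pick S a" using assms by (simp add: p_def b'_def pick_mono)
    then have "{x \<in> S - {pick S a}. x < p} = {x\<in>S. x < p}" by auto
    then show ?thesis using card_p True by (simp add: b'_def)
  next
    case False
    then have "pick S a < p" unfolding p_def using b' by (intro pick_mono) (auto simp: b'_def)
    then have "{x \<in> S - {pick S a}. x < p} = {x\<in>S. x < p} - {pick S a}" "pick S a \<in> {x\<in>S. x < p}"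
      using assms pick_in_set by auto
    then show ?thesis using card_p False assms(1) by (simp add: b'_def)
  qed
  then show ?thesis using pick_card_in_set[OF p] by (simp add: p_def b'_def)
qed

lemma mat_delete_submatrix_principal:
  assumes M: "M \<in> carrier_mat n n" and S: "S \<subseteq> {..<n}" and a: "a < card S"
  shows "mat_delete (submatrix M S S) a a = submatrix M (S - {pick S a}) (S - {pick S a})"
proof -
  have fin: "finite S" using S finite_subset by blast
  have "card (S - {pick S a}) = card S - 1" using a pick_in_set fin by simp
  moreover have "S - {pick S a} \<subseteq> {..<n}" using S by auto
  ultimately show ?thesis
    using a by (auto simp: submatrix_principal[OF M S] submatrix_principal[OF M] mat_delete_def pick_remove[OF fin a])
qed

definition add_diag :: "nat \<Rightarrow> 'a :: comm_ring_1 mat \<Rightarrow> (nat \<Rightarrow> 'a) \<Rightarrow> 'a mat" where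
  "add_diag n M d = mat n n (\<lambda>(i, j). M $$ (i, j) + (if i = j then d i else 0))"

text \<open>The empty minor equals 1; admitting it saves a case distinction when an index is removed
  from a singleton.\<close>

lemma P_matrix_det_principal:
  assumes "P_matrix n M" "S \<subseteq> {..<n}"
  shows "det (submatrix M S S) > 0"
proof (cases "S = {}")
  case True
  then show ?thesis using assms submatrix_principal[of M n "{}"] by (simp add: P_matrix_def)
qed (use assms in \<open>simp add: P_matrix_def\<close>)

text \<open>A principal minor on \<open>S\<close> is unchanged if \<open>k\<close> is not in
  \<open>S\<close>, and otherwise grows by \<open>c\<close> times the positive minor on
  \<open>S - {k}\<close>.\<close>

lemma P_matrix_add_diagonal_entry:
  assumes P: "P_matrix n M" and k: "k < n" and c: "c \<ge> 0"
  shows "P_matrix n (add_diag n M ((\<lambda>_. 0)(k := c)))"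
  unfolding P_matrix_def
proof (intro conjI allI impI)
  define M' where "M' = add_diag n M ((\<lambda>_. 0)(k := c))"
  have M: "M \<in> carrier_mat n n" using P by (simp add: P_matrix_def)
  show M': "add_diag n M ((\<lambda>_. 0)(k := c)) \<in> carrier_mat n n" by (simp add: add_diag_def)
  fix S assume S: "S \<subseteq> {..<n}" "S \<noteq> {}"
  have entry: "M' $$ (pick S i, pick S j) = M $$ (pick S i, pick S j) + (if pick S i = k \<and> pick S j = k then c else 0)"
    if "i < card S" "j < card S" for i j
  proof -
    have "pick S i < n" "pick S j < n" using that S(1) pick_in_set by blast+
    then show ?thesis by (auto simp: M'_def add_diag_def)
  qed
  show "det (submatrix (add_diag n M ((\<lambda>_. 0)(k := c))) S S) > 0"
  proof (cases "k \<in> S")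
    case False
    then have [simp]: "pick S i \<noteq> k" if "i < card S" for i using pick_in_set that by blast
    have "submatrix M' S S = submatrix M S S"
      using M' by (auto simp: submatrix_principal[OF _ S(1)] M M'_def[symmetric] entry)
    then show ?thesis using P_matrix_det_principal[OF P S(1)] by (simp add: M'_def)
  next
    case True
    then obtain a where a: "a < card S" "pick S a = k"
      using bij_betw_imp_surj_on[OF bij_betw_pick[OF finite_subset[OF S(1) finite_lessThan]]]
      by (metis imageE lessThan_iff)
    have [simp]: "pick S i = k \<longleftrightarrow> i = a" if "i < card S" for i using a that pick_inj by blast
    have sub: "submatrix M S S \<in> carrier_mat (card S) (card S)"
      by (simp add: submatrix_principal[OF M S(1)])
    have "submatrix M' S S = mat (card S) (card S)
        (\<lambda>(i, j). submatrix M S S $$ (i, j) + (if i = a \<and> j = a then c else 0))"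
      using M' by (auto simp: submatrix_principal[OF _ S(1)] M M'_def[symmetric] entry)
    then have "det (submatrix M' S S) = det (submatrix M S S) + c * det (submatrix M (S - {k}) (S - {k}))"
      using det_add_diagonal_entry[OF sub a(1)] mat_delete_submatrix_principal[OF M S(1) a(1)] a(2) by simp
    moreover have "S - {k} \<subseteq> {..<n}" using S(1) by auto
    ultimately show ?thesis using P_matrix_det_principal[OF P] S(1) c
      by (simp add: M'_def add_pos_nonneg less_imp_le)
  qed
qed

lemma P_matrix_add_diag:
  assumes "P_matrix n M" "\<And>i. d i \<ge> 0"
  shows "P_matrix n (add_diag n M d)"
proof -
  have "k \<le> n \<Longrightarrow> P_matrix n (add_diag n M (\<lambda>i. if i < k then d i else 0))" for k
  proof (induction k)
    case 0
    have "add_diag n M (\<lambda>i. if i < 0 then d i else 0) = M"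
    proof -
      have "M \<in> carrier_mat n n" using assms(1) by (simp add: P_matrix_def)
      then show ?thesis by (intro eq_matI) (auto simp: add_diag_def)
    qed
    then show ?case using assms(1) by simp
  next
    case (Suc k)
    have eq: "add_diag n M (\<lambda>i. if i < Suc k then d i else 0) =
        add_diag n (add_diag n M (\<lambda>i. if i < k then d i else 0)) ((\<lambda>_. 0)(k := d k))"
      by (rule eq_matI) (auto simp: add_diag_def)
    have "P_matrix n (add_diag n M (\<lambda>i. if i < k then d i else 0))" "k < n" using Suc by simp_all
    then show ?case unfolding eq by (rule P_matrix_add_diagonal_entry) (rule assms(2))
  qed
  moreover have "add_diag n M (\<lambda>i. if i < n then d i else 0) = add_diag n M d"
    by (rule eq_matI) (auto simp: add_diag_def)
  ultimately show ?thesis by (metis order_refl)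
qed

text \<open>If \<open>x \<noteq> 0\<close>, then \<open>M + D\<close> for a suitable diagonal \<open>D \<ge> 0\<close> would have a
  singular principal submatrix on the support of \<open>x\<close>.\<close>

lemma P_matrix_sign_reversal:
  assumes P: "P_matrix n M"
    and x: "\<And>i. i < n \<Longrightarrow> x i * (\<Sum>j<n. M $$ (i, j) * x j) \<le> 0"
    and i: "i < n"
  shows "x i = 0"
proof (rule ccontr)
  assume "x i \<noteq> 0"
  define S where "S = {i. i < n \<and> x i \<noteq> 0}"
  \<comment> \<open>Chosen so that row \<open>k\<close> of the perturbed matrix annihilates
    \<open>x\<close> for every \<open>k\<close> in the support; the sign hypothesis makes it
    nonnegative.\<close>
  define d where "d = (\<lambda>i. if i \<in> S then - (\<Sum>j<n. M $$ (i, j) * x j) / x i else 0)"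
  define M' where "M' = add_diag n M d"
  have S: "S \<subseteq> {..<n}" "finite S" and iS: "i \<in> S" using i \<open>x i \<noteq> 0\<close> by (auto simp: S_def)
  have "d k \<ge> 0" for k
    using x[of k] by (auto simp: d_def S_def mult_le_0_iff divide_le_0_iff)
  then have P': "P_matrix n M'" unfolding M'_def by (intro P_matrix_add_diag P)
  then have M': "M' \<in> carrier_mat n n" by (simp add: P_matrix_def)
  have kernel: "(\<Sum>j\<in>S. M' $$ (k, j) * x j) = 0" if "k \<in> S" for k
  proof -
    have k: "k < n" "x k \<noteq> 0" using that by (auto simp: S_def)
    have "(\<Sum>j\<in>S. M' $$ (k, j) * x j) = (\<Sum>j<n. M' $$ (k, j) * x j)"
      using S by (intro sum.mono_neutral_left) (auto simp: S_def)
    also have "\<dots> = (\<Sum>j<n. M $$ (k, j) * x j + (if k = j then d k * x k else 0))"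
      using k by (intro sum.cong) (auto simp: M'_def add_diag_def algebra_simps)
    also have "\<dots> = (\<Sum>j<n. M $$ (k, j) * x j) + d k * x k"
      using k by (simp add: sum.distrib)
    also have "\<dots> = 0" using k that by (simp add: d_def)
    finally show ?thesis .
  qed
  define y where "y = vec (card S) (\<lambda>a. x (pick S a))"
  have "submatrix M' S S *\<^sub>v y = 0\<^sub>v (card S)"
  proof
    fix a assume "a < dim_vec (0\<^sub>v (card S))"
    then have a: "a < card S" by simp
    have "(submatrix M' S S *\<^sub>v y) $ a = (\<Sum>b<card S. M' $$ (pick S a, pick S b) * x (pick S b))"
      using a by (simp add: submatrix_principal[OF M' S(1)] y_def scalar_prod_def lessThan_atLeast0)
    also have "\<dots> = (\<Sum>j\<in>S. M' $$ (pick S a, j) * x j)"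
      by (rule sum.reindex_bij_betw[OF bij_betw_pick[OF S(2)]])
    finally show "(submatrix M' S S *\<^sub>v y) $ a = 0\<^sub>v (card S) $ a"
      using kernel a pick_in_set by simp
  qed (simp add: submatrix_principal[OF M' S(1)])
  moreover have "y \<noteq> 0\<^sub>v (card S)"
  proof
    assume "y = 0\<^sub>v (card S)"
    obtain a where "a < card S" "pick S a = i"
      using iS bij_betw_imp_surj_on[OF bij_betw_pick[OF S(2)]] by (metis imageE lessThan_iff)
    with \<open>y = 0\<^sub>v (card S)\<close> \<open>x i \<noteq> 0\<close> show False by (metis index_vec index_zero_vec(1) y_def)
  qed
  moreover have "y \<in> carrier_vec (card S)" by (simp add: y_def)
  moreover have "submatrix M' S S \<in> carrier_mat (card S) (card S)"
    by (simp add: submatrix_principal[OF M' S(1)])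
  ultimately have "det (submatrix M' S S) = 0" using det_0_iff_vec_prod_zero by blast
  with P_matrix_det_principal[OF P' S(1)] show False by simp
qed

section \<open>The linear systems attached to the vertices and their outmaps\<close>

lemma A_mat_carrier [simp]: "A_mat n M B \<in> carrier_mat n n"
  by (simp add: A_mat_def)

text \<open>The complementary form \<open>w - M z\<close> of the system: \<open>z\<close> is the
  part of \<open>x\<close> on \<open>B\<close> and \<open>w\<close> the part off
  \<open>B\<close>.\<close>

lemma A_mat_mult_vec:
  assumes "x \<in> carrier_vec n" "i < n"
  shows "(A_mat n M B *\<^sub>v x) $ i =
    (if i \<in> B then 0 else x $ i) - (\<Sum>j<n. M $$ (i, j) * (if j \<in> B then x $ j else 0))"
proof -
  have "(A_mat n M B *\<^sub>v x) $ i = (\<Sum>j<n. (if j \<in> B then - (M $$ (i, j)) else if i = j then 1 else 0) * x $ j)"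
    using assms by (simp add: A_mat_def scalar_prod_def lessThan_atLeast0)
  also have "\<dots> = (\<Sum>j<n. (if i = j then if i \<in> B then 0 else x $ i else 0) - M $$ (i, j) * (if j \<in> B then x $ j else 0))"
    by (intro sum.cong) auto
  also have "\<dots> = (if i \<in> B then 0 else x $ i) - (\<Sum>j<n. M $$ (i, j) * (if j \<in> B then x $ j else 0))"
    using assms by (simp add: sum_subtractf)
  finally show ?thesis .
qed

text \<open>Writing the two solutions as \<open>w - M z = q = w' - M z'\<close> with \<open>w, z\<close> (and \<open>w', z'\<close>)
  supported on complementary sets, \<open>z - z'\<close> contradicts the sign reversal property unless it vanishes.\<close>

lemma lcp_solutions_agree:
  assumes P: "P_matrix n M"
    and x: "x \<in> carrier_vec n" "A_mat n M u *\<^sub>v x = q"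
    and y: "y \<in> carrier_vec n" "A_mat n M v *\<^sub>v y = q"
    and sgn: "\<And>i. i < n \<Longrightarrow> i \<in> flip u v \<Longrightarrow> x $ i * y $ i \<ge> 0"
  shows "x = y" and "\<And>i. i < n \<Longrightarrow> i \<in> flip u v \<Longrightarrow> x $ i = 0"
proof -
  define z where "z = (\<lambda>j. (if j \<in> u then x $ j else 0) - (if j \<in> v then y $ j else 0))"
  have w: "(\<Sum>j<n. M $$ (i, j) * z j) = (if i \<in> u then 0 else x $ i) - (if i \<in> v then 0 else y $ i)"
    if i: "i < n" for i
  proof -
    have "(A_mat n M u *\<^sub>v x) $ i = (A_mat n M v *\<^sub>v y) $ i" using x y by simp
    then show ?thesis
      unfolding A_mat_mult_vec[OF x(1) i] A_mat_mult_vec[OF y(1) i] z_def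
      by (simp add: right_diff_distrib sum_subtractf)
  qed
  \<comment> \<open>On \<open>flip u v\<close> the product is \<open>- (x $ i * y $ i)\<close>;
    elsewhere one of its factors is 0.\<close>
  have "z i * (\<Sum>j<n. M $$ (i, j) * z j) \<le> 0" if "i < n" for i
    unfolding w[OF that] using sgn[OF that] by (auto simp: z_def flip_def mult.commute)
  then have z0: "z i = 0" if "i < n" for i using P_matrix_sign_reversal[OF P] that by blast
  have agree: "(if i \<in> u then 0 else x $ i) = (if i \<in> v then 0 else y $ i)"
    "(if i \<in> u then x $ i else 0) = (if i \<in> v then y $ i else 0)" if "i < n" for i
  proof -
    show "(if i \<in> u then 0 else x $ i) = (if i \<in> v then 0 else y $ i)"
    proof -
      have "(\<Sum>j<n. M $$ (i, j) * z j) = 0" using z0 by (intro sum.neutral) auto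
      then show ?thesis using w[OF that] by simp
    qed
    show "(if i \<in> u then x $ i else 0) = (if i \<in> v then y $ i else 0)"
      using z0[OF that] by (simp add: z_def)
  qed
  show "x $ i = 0" if "i < n" "i \<in> flip u v" for i
    using agree[OF that(1)] that(2) by (auto simp: flip_def split: if_splits)
  show "x = y"
  proof
    fix i assume "i < dim_vec y"
    then have "i < n" using y(1) by simp
    from agree[OF this] show "x $ i = y $ i" by (auto split: if_splits)
  qed (use x y in simp)
qed

text \<open>A kernel vector and the zero vector solve the same system at the same vertex, where the
  sign condition is vacuous, so they agree.\<close>

lemma A_mat_det_nonzero:
  assumes P: "P_matrix n M"
  shows "det (A_mat n M B) \<noteq> 0"
proof
  assume "det (A_mat n M B) = 0"
  then obtain x where x: "x \<in> carrier_vec n" "x \<noteq> 0\<^sub>v n" "A_mat n M B *\<^sub>v x = 0\<^sub>v n"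
    using det_0_iff_vec_prod_zero[of "A_mat n M B" n] by auto
  have "A_mat n M B *\<^sub>v 0\<^sub>v n = 0\<^sub>v n" by (auto simp: A_mat_def)
  then have "x = 0\<^sub>v n"
    by (intro lcp_solutions_agree(1)[OF P x(1,3), of "0\<^sub>v n" B]) (auto simp: flip_def)
  with x(2) show False by simp
qed

lemma lcp_sol_unique:
  assumes "P_matrix n M" "x \<in> carrier_vec n" "A_mat n M B *\<^sub>v x = q"
  shows "lcp_sol n M q B = x"
  unfolding lcp_sol_def using assms
  by (intro the_equality) (auto intro!: lcp_solutions_agree(1)[of n M _ B q _ B] simp: flip_def)

lemma lcp_sol:
  assumes P: "P_matrix n M" and q: "q \<in> carrier_vec n"
  shows "lcp_sol n M q B \<in> carrier_vec n" and "A_mat n M B *\<^sub>v lcp_sol n M q B = q"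
proof -
  let ?A = "A_mat n M B"
  define x where "x = (1 / det ?A) \<cdot>\<^sub>v (adj_mat ?A *\<^sub>v q)"
  note adj = adj_mat[OF A_mat_carrier[of n M B]]
  have x: "x \<in> carrier_vec n" unfolding x_def using adj(1) q by simp
  have "?A *\<^sub>v (adj_mat ?A *\<^sub>v q) = det ?A \<cdot>\<^sub>v q"
    using adj q by (simp flip: assoc_mult_mat_vec[OF A_mat_carrier adj(1) q]) auto
  then have "?A *\<^sub>v x = q" unfolding x_def using adj(1) q A_mat_det_nonzero[OF P]
    by (subst mult_mat_vec[of _ n n]) (auto simp: smult_smult_assoc)
  with x lcp_sol_unique[OF P] show "lcp_sol n M q B \<in> carrier_vec n" "?A *\<^sub>v lcp_sol n M q B = q"
    by metis+
qed

text \<open>The Szabo-Welzl condition. Outmaps agreeing on \<open>flip u v\<close> would mean equal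
  signs of the two solutions there, which forces a zero entry and contradicts nondegeneracy.\<close>

lemma lcp_orientations_differ:
  assumes nd: "nondegenerate n M q" and uv: "u \<subseteq> {..<n}" "v \<subseteq> {..<n}" "u \<noteq> v"
  shows "\<exists>i \<in> flip u v. lcp_orientation n M q u i \<noteq> lcp_orientation n M q v i"
proof (rule ccontr)
  assume eq: "\<not> (\<exists>i \<in> flip u v. lcp_orientation n M q u i \<noteq> lcp_orientation n M q v i)"
  have P: "P_matrix n M" and q: "q \<in> carrier_vec n" using nd by (auto simp: nondegenerate_def)
  obtain i where i: "i \<in> flip u v" using uv(3) by (auto simp: flip_def)
  then have "i < n" using uv by (auto simp: flip_def)
  have "lcp_sol n M q u $ i * lcp_sol n M q v $ i \<ge> 0" if "i \<in> flip u v" "i < n" for i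
    using eq that uv by (auto simp: lcp_orientation_def not_less mult_nonneg_nonneg mult_nonpos_nonpos)
  then have "lcp_sol n M q u $ i = 0"
    by (rule lcp_solutions_agree(2)[OF P lcp_sol[OF P q] lcp_sol[OF P q] _ \<open>i < n\<close> i])
  then show False using nd uv(1) \<open>i < n\<close> by (simp add: nondegenerate_def)
qed

text \<open>The outmap is injective on every subcube, hence onto, so that it attains the empty set.\<close>

lemma nondegenerate_is_USO:
  assumes nd: "nondegenerate n M q"
  shows "is_USO n (lcp_orientation n M q)"
  unfolding is_USO_def is_orientation_def
proof (intro conjI allI impI)
  let ?Or = "lcp_orientation n M q"
  show "\<not> ?Or v i" if "\<not> (v \<subseteq> {..<n} \<and> i < n)" for v i
    using that by (auto simp: lcp_orientation_def)
  \<comment> \<open>For neighbours \<open>v\<close> and \<open>flip v {i}\<close> the only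
    coordinate in which the outmaps can be asserted to differ is \<open>i\<close> itself.\<close>
  show "?Or v i \<longleftrightarrow> \<not> ?Or (flip v {i}) i" if "v \<subseteq> {..<n} \<and> i < n" for v i
  proof -
    have "flip v {i} \<subseteq> {..<n}" "flip v {i} \<noteq> v" "flip v (flip v {i}) = {i}"
      using that by (auto simp: flip_def)
    then show ?thesis using lcp_orientations_differ[OF nd, of v "flip v {i}"] that by auto
  qed
  fix C v :: "nat set" assume C: "C \<subseteq> {..<n}" and v: "v \<subseteq> {..<n}"
  define Q where "Q = {flip v I | I. I \<subseteq> C}"
  define s where "s = (\<lambda>w. {i\<in>C. ?Or w i})"
  have finC: "finite C" using C finite_subset by blast
  have Q_image: "Q = flip v ` Pow C" by (auto simp: Q_def)
  have "inj_on (flip v) (Pow C)" by (auto simp: inj_on_def flip_def)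
  then have cardQ: "card Q = card (Pow C)" unfolding Q_image by (rule card_image)
  have injs: "inj_on s Q"
  proof (rule inj_onI, rule ccontr)
    fix w w' assume w: "w \<in> Q" "w' \<in> Q" "s w = s w'" "w \<noteq> w'"
    have "w \<subseteq> {..<n}" "w' \<subseteq> {..<n}" using w v C by (auto simp: Q_def flip_def)
    from lcp_orientations_differ[OF nd this w(4)]
    obtain i where "i \<in> flip w w'" "?Or w i \<noteq> ?Or w' i" by blast
    moreover have "flip w w' \<subseteq> C" using w by (auto simp: Q_def flip_def)
    ultimately show False using w(3) by (auto simp: s_def)
  qed
  have "s ` Q = Pow C"
    using finC card_image[OF injs] cardQ by (intro card_subset_eq) (auto simp: s_def)
  then obtain w where "w \<in> Q" "s w = {}" by (metis Pow_bottom imageE)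
  then have "\<exists>!w. w \<in> Q \<and> s w = {}"
  proof (intro ex1I[of _ w] conjI)
    show "w' = w" if "w' \<in> Q \<and> s w' = {}" for w'
      by (rule inj_onD[OF injs]) (use that \<open>w \<in> Q\<close> \<open>s w = {}\<close> in auto)
  qed
  moreover have "s w = {} \<longleftrightarrow> (\<forall>i\<in>C. \<not> ?Or w i)" for w by (auto simp: s_def)
  ultimately show "\<exists>!w. w \<in> {flip v I | I. I \<subseteq> C} \<and> (\<forall>i\<in>C. \<not> ?Or w i)" by (simp add: Q_def)
qed

text \<open>As \<open>pick\<close> is increasing, principal submatrices inherit the unitriangular
  shape and have determinant 1.\<close>

lemma P_matrix_unitriangular:
  assumes M: "M \<in> carrier_mat n n"
    and diag: "\<And>i. i < n \<Longrightarrow> M $$ (i, i) = 1"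
    and upper: "\<And>i j. j < i \<Longrightarrow> i < n \<Longrightarrow> M $$ (i, j) = 0"
  shows "P_matrix n M"
  unfolding P_matrix_def
proof (intro conjI allI impI)
  fix S assume S: "S \<subseteq> {..<n}"
  let ?A = "mat (card S) (card S) (\<lambda>(a, b). M $$ (pick S a, pick S b))"
  have lt: "pick S a < n" if "a < card S" for a using pick_in_set[of a S] that S by auto
  have "upper_triangular ?A"
    using lt by (auto simp: upper pick_mono)
  then have "det ?A = prod_list (diag_mat ?A)" by (rule det_upper_triangular[OF _ mat_carrier])
  also have "diag_mat ?A = replicate (card S) 1"
    by (rule nth_equalityI) (auto simp: diag_mat_def diag lt)
  finally show "det (submatrix M S S) > 0" by (simp add: submatrix_principal[OF M S])
qed (rule M)

section \<open>The upper bound\<close>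

lemma poly_fun_det:
  assumes "\<And>i j. i < n \<Longrightarrow> j < n \<Longrightarrow> poly_fun I d (a i j)"
  shows "poly_fun I (n * d) (\<lambda>x. det (mat n n (\<lambda>(i, j). a i j x)))"
proof -
  have "det (mat n n (\<lambda>(i, j). a i j x)) =
      (\<Sum>p | p permutes {0..<n}. signof p * (\<Prod>i = 0..<n. a i (p i) x))" for x
    by (subst det_def'[of _ n]) (auto intro!: sum.cong prod.cong simp: permutes_in_image)
  moreover have "poly_fun I (n * d) (\<lambda>x. \<Sum>p | p permutes {0..<n}. signof p * (\<Prod>i = 0..<n. a i (p i) x))"
  proof (intro poly_fun_sum poly_fun_cmult)
    fix p assume p: "p \<in> {p. p permutes {0..<n}}"
    then have "p i < n" if "i < n" for i using that permutes_in_image[of p "{0..<n}" i] by simp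
    then show "poly_fun I (n * d) (\<lambda>x. \<Prod>i = 0..<n. a i (p i) x)"
      using poly_fun_prod[of "{0..<n}" I d "\<lambda>i. a i (p i)"] assms by simp
  qed
  ultimately show ?thesis by presburger
qed

text \<open>Column \<open>n\<close> holds \<open>q\<close>, so that the pair becomes one point in
  the \<open>n * (n + 1)\<close> variables indexed by \<open>{..<n} \<times> {..n}\<close>.\<close>

definition lcp_param :: "nat \<Rightarrow> real mat \<Rightarrow> real vec \<Rightarrow> nat \<times> nat \<Rightarrow> real" where
  "lcp_param n M q = (\<lambda>(i, j). if j = n then q $ i else M $$ (i, j))"

definition lcp_entry :: "nat set \<Rightarrow> nat \<Rightarrow> nat \<Rightarrow> (nat \<times> nat \<Rightarrow> real) \<Rightarrow> real" where
  "lcp_entry B i j x = (if j \<in> B then - x (i, j) else if i = j then 1 else 0)"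

text \<open>By Cramer's rule this is \<open>(det A\<^sub>B)\<^sup>2\<close> times the \<open>k\<close>th entry of \<open>A\<^sub>B\<^sup>-\<^sup>1 q\<close>.\<close>

definition lcp_poly :: "nat \<Rightarrow> nat set \<times> nat \<Rightarrow> (nat \<times> nat \<Rightarrow> real) \<Rightarrow> real" where
  "lcp_poly n = (\<lambda>(B, k) x. det (mat n n (\<lambda>(i, j). lcp_entry B i j x)) *
     det (mat n n (\<lambda>(i, j). if j = k then x (i, n) else lcp_entry B i j x)))"

lemma poly_fun_lcp_poly: "poly_fun ({..<n} \<times> {..n}) (2 * n) (lcp_poly n (B, k))"
proof -
  let ?I = "{..<n} \<times> {..n}"
  have var: "poly_fun ?I 1 (\<lambda>x. x (i, j))" if "i < n" "j \<le> n" for i j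
    using that by (intro poly_fun_var) auto
  have entry: "poly_fun ?I 1 (lcp_entry B i j)" if "i < n" "j < n" for i j
    using poly_fun_cmult[OF var[of i j], of "-1"] poly_fun_const[of ?I 1] that
    by (cases "j \<in> B") (auto simp: lcp_entry_def[abs_def])
  have "poly_fun ?I 1 (\<lambda>x. if j = k then x (i, n) else lcp_entry B i j x)" if "i < n" "j < n" for i j
    using var[of i n] entry[of i j] that by (cases "j = k") auto
  with entry have "poly_fun ?I (n * 1 + n * 1) (\<lambda>x. det (mat n n (\<lambda>(i, j). lcp_entry B i j x)) *
      det (mat n n (\<lambda>(i, j). if j = k then x (i, n) else lcp_entry B i j x)))"
    by (intro poly_fun_mult poly_fun_det)
  then show ?thesis by (simp add: lcp_poly_def mult_2)
qed

text \<open>The determinant of \<open>A_mat n M B\<close> may have either sign; its square does not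
  disturb the sign of the solution entry.\<close>

lemma lcp_poly_param:
  assumes P: "P_matrix n M" and q: "q \<in> carrier_vec n" and B: "B \<subseteq> {..<n}" and k: "k < n"
  shows "lcp_poly n (B, k) (lcp_param n M q) = (det (A_mat n M B))\<^sup>2 * lcp_sol n M q B $ k"
proof -
  let ?A = "A_mat n M B"
  have A: "mat n n (\<lambda>(i, j). lcp_entry B i j (lcp_param n M q)) = ?A"
    using B by (intro eq_matI) (auto simp: A_mat_def lcp_entry_def lcp_param_def)
  have "mat n n (\<lambda>(i, j). if j = k then lcp_param n M q (i, n) else lcp_entry B i j (lcp_param n M q)) =
      replace_col ?A q k"
    using q by (intro eq_matI) (auto simp: replace_col_def lcp_param_def lcp_entry_def A_mat_def)
  also have "det \<dots> = lcp_sol n M q B $ k * det ?A"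
    using cramer_lemma_mat[OF A_mat_carrier lcp_sol(1)[OF P q] k] lcp_sol(2)[OF P q] by metis
  finally show ?thesis by (simp add: lcp_poly_def A power2_eq_square)
qed

text \<open>The orientation is read off the sign pattern of the polynomials at the parameter point.
  Finiteness is recorded as well, since \<open>card\<close> is 0 on infinite sets and the lower
  bound relies on monotonicity of \<open>card\<close>.\<close>

lemma finite_P_USOs_and_card_le:
  "finite (P_USOs n) \<and> card (P_USOs n) \<le> (4 * n\<^sup>2 * 2 ^ n + 1) ^ (n * (n + 1))"
proof -
  define J where "J = Pow {..<n} \<times> {..<n}"
  define \<Sigma> where "\<Sigma> = {{j\<in>J. lcp_poly n j x < 0} | x. \<forall>j\<in>J. lcp_poly n j x \<noteq> 0}"
  have "finite J" by (simp add: J_def)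
  have "finite \<Sigma>" unfolding \<Sigma>_def using \<open>finite J\<close> by (auto intro: finite_subset[of _ "Pow J"])
  have "P_USOs n \<subseteq> (\<lambda>\<sigma> v i. (v, i) \<in> \<sigma>) ` \<Sigma>"
  proof
    fix Or assume "Or \<in> P_USOs n"
    then obtain M q where nd: "nondegenerate n M q" and Or: "Or = lcp_orientation n M q"
      by (auto simp: P_USOs_def)
    have P: "P_matrix n M" and q: "q \<in> carrier_vec n" using nd by (auto simp: nondegenerate_def)
    let ?x = "lcp_param n M q"
    have pos: "(det (A_mat n M B))\<^sup>2 > 0" for B using A_mat_det_nonzero[OF P] by simp
    have "lcp_poly n j ?x \<noteq> 0" if "j \<in> J" for j
      using that nd pos lcp_poly_param[OF P q]
      by (auto simp: J_def nondegenerate_def A_mat_det_nonzero[OF P])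
    then have "{j\<in>J. lcp_poly n j ?x < 0} \<in> \<Sigma>" by (auto simp: \<Sigma>_def)
    moreover have "Or = (\<lambda>v i. (v, i) \<in> {j\<in>J. lcp_poly n j ?x < 0})"
    proof (intro ext)
      fix v i
      show "Or v i = ((v, i) \<in> {j\<in>J. lcp_poly n j ?x < 0})"
      proof (cases "(v, i) \<in> J")
        case True
        then have "lcp_poly n (v, i) ?x < 0 \<longleftrightarrow> lcp_sol n M q v $ i < 0"
          using lcp_poly_param[OF P q, of v i] pos[of v] by (simp add: J_def mult_less_0_iff)
        with True show ?thesis by (simp add: Or lcp_orientation_def J_def)
      qed (auto simp: Or lcp_orientation_def J_def)
    qed
    ultimately show "Or \<in> (\<lambda>\<sigma> v i. (v, i) \<in> \<sigma>) ` \<Sigma>" by blast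
  qed
  note sub = this finite_imageI[OF \<open>finite \<Sigma>\<close>]
  have "card (P_USOs n) \<le> card ((\<lambda>\<sigma> v i. (v, i) \<in> \<sigma>) ` \<Sigma>)" by (rule card_mono[OF sub(2,1)])
  also have "\<dots> \<le> card \<Sigma>" by (rule card_image_le[OF \<open>finite \<Sigma>\<close>])
  \<comment> \<open>There are \<open>n * 2 ^ n\<close> polynomials of degree at most
    \<open>2 * n\<close>.\<close>
  also have "\<dots> \<le> (2 * (card J * (2 * n)) + 1) ^ card ({..<n} \<times> {..n})"
    unfolding \<Sigma>_def using \<open>finite J\<close> poly_fun_lcp_poly
    by (intro card_sign_patterns_le) (auto simp: J_def)
  also have "\<dots> = (4 * n\<^sup>2 * 2 ^ n + 1) ^ (n * (n + 1))"
    by (simp add: J_def card_cartesian_product card_Pow power2_eq_square algebra_simps)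
  finally show ?thesis using finite_subset[OF sub] by blast
qed

lemma card_P_USOs_le:
  assumes "n \<ge> 1"
  shows "card (P_USOs n) \<le> 2 ^ (12 * n ^ 3)"
proof -
  \<comment> \<open>This crude bound on the square puts the base below
    \<open>2 ^ (3 * n + 3)\<close>, hence below \<open>2 ^ (6 * n)\<close>.\<close>
  have n2: "n\<^sup>2 \<le> (2 ^ n)\<^sup>2" using less_exp[of n] by (intro power_mono) auto
  have "4 * n\<^sup>2 * 2 ^ n + 1 \<le> 4 * (2 ^ n)\<^sup>2 * 2 ^ n + 4 * (2 ^ n)\<^sup>2 * (2 ^ n :: nat)"
    using n2 by (intro add_mono mult_mono) (auto simp: Suc_le_eq)
  also have "\<dots> = 8 * ((2 ^ n)\<^sup>2 * 2 ^ n)" by simp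
  also have "\<dots> = 2 ^ 3 * 2 ^ (3 * n)" by (simp flip: power_mult power_add)
  also have "\<dots> \<le> 2 ^ (6 * n)" unfolding power_add[symmetric]
    using assms by (intro power_increasing) auto
  finally have "4 * n\<^sup>2 * 2 ^ n + 1 \<le> (2::nat) ^ (6 * n)" .
  then have "(4 * n\<^sup>2 * 2 ^ n + 1) ^ (n * (n + 1)) \<le> ((2::nat) ^ (6 * n)) ^ (n * (n + 1))"
    by (rule power_mono) simp
  also have "\<dots> = 2 ^ (6 * n * (n * (n + 1)))" by (simp only: power_mult)
  also have "\<dots> \<le> 2 ^ (12 * n ^ 3)"
  proof (intro power_increasing)
    have "n * (n + 1) \<le> n * (2 * n)" using assms by (intro mult_left_mono) auto
    then have "6 * n * (n * (n + 1)) \<le> 6 * n * (n * (2 * n))" by (rule mult_left_mono) simp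
    then show "6 * n * (n * (n + 1)) \<le> 12 * n ^ 3" by (simp add: power3_eq_cube)
  qed simp
  finally show ?thesis using finite_P_USOs_and_card_le[of n] by simp
qed


section \<open>The lower bound\<close>

text \<open>The matrix \<open>N\<close>, with blocks X, Y, Z at \<open>{..<m}\<close>,
  \<open>{m..<2*m}\<close>, \<open>{2*m..<3*m}\<close>. Rows in X reach only into Y and rows in Y
  only into Z, which makes \<open>N\<close> strictly upper triangular.\<close>

definition thr_coeff :: "nat \<Rightarrow> (nat \<times> nat \<Rightarrow> nat) \<Rightarrow> nat \<Rightarrow> nat \<Rightarrow> real" where
  "thr_coeff m t r c =
    (if r < m \<and> m \<le> c \<and> c < 2 * m then 1 / t (r, c - m)
     else if m \<le> r \<and> r < 2 * m \<and> 2 * m \<le> c \<and> c < 3 * m then 2 ^ (c - 2 * m)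
     else 0)"

definition thr_matrix :: "nat \<Rightarrow> nat \<Rightarrow> (nat \<times> nat \<Rightarrow> nat) \<Rightarrow> real mat" where
  "thr_matrix n m t = mat n n (\<lambda>(r, c). (if r = c then 1 else 0) - thr_coeff m t r c)"

text \<open>Coordinates from \<open>3 * m\<close> on pad the cube to dimension \<open>n\<close>; the
  entry 1 keeps their solution entries nonzero.\<close>

definition thr_rhs :: "nat \<Rightarrow> real \<Rightarrow> nat \<Rightarrow> real" where
  "thr_rhs m \<theta> r = (if r < m then \<theta> else if r < 3 * m then -1 else 1)"

text \<open>The number whose binary digits are given by the Z part of \<open>B\<close>.\<close>

definition thr_code :: "nat \<Rightarrow> nat set \<Rightarrow> real" where
  "thr_code m B = (\<Sum>c\<in>B \<inter> {2*m..<3*m}. 2 ^ (c - 2 * m))"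

definition thr_load :: "nat \<Rightarrow> (nat \<times> nat \<Rightarrow> nat) \<Rightarrow> nat set \<Rightarrow> nat \<Rightarrow> real" where
  "thr_load m t B r = (\<Sum>c\<in>B \<inter> {m..<2*m}. (1 + thr_code m B) / t (r, c - m))"

text \<open>For \<open>r \<notin> B\<close> this is the \<open>r\<close>th entry of \<open>A\<^sub>B\<^sup>-\<^sup>1 q\<close>, for \<open>r \<in> B\<close> its negative.\<close>

definition thr_value :: "nat \<Rightarrow> (nat \<times> nat \<Rightarrow> nat) \<Rightarrow> real \<Rightarrow> nat set \<Rightarrow> nat \<Rightarrow> real" where
  "thr_value m t \<theta> B r =
    (if r < m then \<theta> - thr_load m t B r
     else if r < 2 * m then - (1 + thr_code m B)
     else if r < 3 * m then -1 else 1)"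

lemma thr_coeff_upper: "thr_coeff m t r c \<noteq> 0 \<Longrightarrow> r < c"
  by (auto simp: thr_coeff_def split: if_splits)

lemma thr_matrix_K: "K_matrix n (thr_matrix n m t)"
proof -
  have carrier: "thr_matrix n m t \<in> carrier_mat n n" by (simp add: thr_matrix_def)
  have "thr_coeff m t r c \<ge> 0" for r c by (simp add: thr_coeff_def)
  then have "Z_matrix n (thr_matrix n m t)" using carrier by (auto simp: Z_matrix_def thr_matrix_def)
  moreover have "thr_coeff m t r c = 0" if "c \<le> r" for r c using thr_coeff_upper[of m t r c] that by force
  then have "P_matrix n (thr_matrix n m t)"
    by (intro P_matrix_unitriangular carrier) (simp_all add: thr_matrix_def)
  ultimately show ?thesis by (simp add: K_matrix_def)
qed

text \<open>Back substitution in the triangular system \<open>u = q + N u'\<close>, where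
  \<open>u'\<close> is \<open>u\<close> restricted to \<open>B\<close>: block Z first, then Y, then
  X. Negating \<open>u\<close> on \<open>B\<close> turns this system into the one for
  \<open>A_mat\<close>.\<close>

lemma thr_value_recursion:
  assumes n: "3 * m \<le> n" and B: "B \<subseteq> {..<n}"
  shows "thr_value m t \<theta> B r = thr_rhs m \<theta> r + (\<Sum>c\<in>B. thr_coeff m t r c * thr_value m t \<theta> B c)"
proof -
  have fin: "finite B" using B finite_subset by blast
  consider "r < m" | "m \<le> r" "r < 2 * m" | "2 * m \<le> r" by linarith
  then show ?thesis
  proof cases
    case 1
    have "(\<Sum>c\<in>B. thr_coeff m t r c * thr_value m t \<theta> B c) =
        (\<Sum>c\<in>B \<inter> {m..<2*m}. - ((1 + thr_code m B) / t (r, c - m)))"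
      using 1 fin by (intro sum.mono_neutral_cong_right)
        (auto simp: thr_coeff_def thr_value_def add_divide_distrib diff_divide_distrib)
    then show ?thesis using 1 by (simp add: thr_value_def thr_rhs_def thr_load_def sum_negf)
  next
    case 2
    have "(\<Sum>c\<in>B. thr_coeff m t r c * thr_value m t \<theta> B c) =
        (\<Sum>c\<in>B \<inter> {2*m..<3*m}. - (2 ^ (c - 2 * m)))"
      using 2 fin by (intro sum.mono_neutral_cong_right) (auto simp: thr_coeff_def thr_value_def)
    then show ?thesis using 2 by (simp add: thr_value_def thr_rhs_def thr_code_def sum_negf)
  next
    case 3
    then have "thr_coeff m t r c = 0" for c by (simp add: thr_coeff_def)
    then show ?thesis using 3 by (simp add: thr_value_def thr_rhs_def)
  qed
qed

lemma lcp_sol_thr: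
  assumes n: "3 * m \<le> n" and B: "B \<subseteq> {..<n}" and i: "i < n"
  shows "lcp_sol n (thr_matrix n m t) (vec n (thr_rhs m \<theta>)) B $ i =
    (if i \<in> B then - thr_value m t \<theta> B i else thr_value m t \<theta> B i)"
proof -
  let ?M = "thr_matrix n m t" and ?u = "thr_value m t \<theta> B"
  define x where "x = vec n (\<lambda>r. if r \<in> B then - ?u r else ?u r)"
  have x: "x \<in> carrier_vec n" by (simp add: x_def)
  have "A_mat n ?M B *\<^sub>v x = vec n (thr_rhs m \<theta>)"
  proof
    fix r assume "r < dim_vec (vec n (thr_rhs m \<theta>))"
    then have r: "r < n" by simp
    have "(\<Sum>c<n. ?M $$ (r, c) * (if c \<in> B then x $ c else 0)) =
        (\<Sum>c<n. (if c = r then if r \<in> B then - ?u r else 0 else 0) + (if c \<in> B then thr_coeff m t r c * ?u c else 0))"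
      using r by (intro sum.cong) (auto simp: thr_matrix_def x_def algebra_simps)
    also have "\<dots> = (if r \<in> B then - ?u r else 0) + (\<Sum>c<n. if c \<in> B then thr_coeff m t r c * ?u c else 0)"
      using r by (simp add: sum.distrib)
    also have "(\<Sum>c<n. if c \<in> B then thr_coeff m t r c * ?u c else 0) = (\<Sum>c\<in>B. thr_coeff m t r c * ?u c)"
      using B by (simp add: sum.inter_restrict[symmetric] Int_absorb1 flip: sum.inter_restrict)
    finally show "(A_mat n ?M B *\<^sub>v x) $ r = vec n (thr_rhs m \<theta>) $ r"
      unfolding A_mat_mult_vec[OF x r] using r thr_value_recursion[OF n B, of t \<theta> r]
      by (simp add: x_def)
  qed (simp add: A_mat_def)
  then have "lcp_sol n ?M (vec n (thr_rhs m \<theta>)) B = x"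
    using thr_matrix_K x by (intro lcp_sol_unique) (auto simp: K_matrix_def)
  then show ?thesis using i by (simp add: x_def)
qed

text \<open>Making \<open>\<theta>\<close> generic only serves nondegeneracy; its upper bound keeps it from crossing a
  threshold.\<close>

lemma thr_generic:
  obtains \<theta> :: real where "1 < \<theta>" "\<theta> < 1 + 1 / 2 ^ m"
    "\<And>B r. B \<subseteq> {..<n} \<Longrightarrow> r < m \<Longrightarrow> thr_load m t B r \<noteq> \<theta>"
proof -
  define F where "F = (\<lambda>(B, r). thr_load m t B r) ` (Pow {..<n} \<times> {..<m})"
  have "finite F" by (simp add: F_def)
  moreover have "infinite {1 <..< 1 + 1 / 2 ^ m :: real}" by (simp add: infinite_Ioo_iff)
  ultimately have "infinite ({1 <..< 1 + 1 / 2 ^ m} - F)" by (rule Diff_infinite_finite)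
  then obtain \<theta> where "\<theta> \<in> {1 <..< 1 + 1 / 2 ^ m} - F" by (metis finite.emptyI ex_in_conv)
  then show ?thesis using that[of \<theta>] by (force simp: F_def)
qed

text \<open>Outside X the entries are, up to sign, 1 or \<open>1 + thr_code m B\<close>, which is at
  least 1. Only the entries in X could vanish, and \<theta> avoids this.\<close>

lemma thr_nondegenerate:
  assumes n: "3 * m \<le> n" and \<theta>: "\<And>B r. B \<subseteq> {..<n} \<Longrightarrow> r < m \<Longrightarrow> thr_load m t B r \<noteq> \<theta>"
  shows "nondegenerate n (thr_matrix n m t) (vec n (thr_rhs m \<theta>))"
proof -
  have "thr_code m B \<ge> 0" for B unfolding thr_code_def by (intro sum_nonneg) simp
  then have "thr_code m B \<noteq> -1" for B by (smt (verit))
  then have "thr_value m t \<theta> B i \<noteq> 0" if "B \<subseteq> {..<n}" for B i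
    using \<theta>[OF that, of i] by (auto simp: thr_value_def eq_commute[of "-1"])
  then show ?thesis using thr_matrix_K lcp_sol_thr[OF n]
    by (auto simp: nondegenerate_def K_matrix_def)
qed

lemma thr_orientation:
  assumes n: "3 * m \<le> n" and \<theta>: "1 < \<theta>" "\<theta> < 1 + 1 / 2 ^ m"
    and ij: "i < m" "j < m" and t: "1 \<le> t (i, j)" "t (i, j) \<le> 2 ^ m" and s: "s < 2 ^ m"
  shows "lcp_orientation n (thr_matrix n m t) (vec n (thr_rhs m \<theta>))
    (insert (m + j) ((+) (2 * m) ` set_decode s)) i \<longleftrightarrow> t (i, j) \<le> s"
proof -
  define B where "B = insert (m + j) ((+) (2 * m) ` set_decode s)"
  have decode: "set_decode s \<subseteq> {..<m}"
  proof
    fix k assume "k \<in> set_decode s"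
    then have "odd (s div 2 ^ k)" by (simp add: set_decode_def)
    then have "s div 2 ^ k \<noteq> 0" by (metis even_zero)
    then have "2 ^ k < (2 ^ m :: nat)" using s by (metis div_less le_less_trans not_less)
    then show "k \<in> {..<m}" by simp
  qed
  have B: "B \<subseteq> {..<n}" "i < n" "i \<notin> B" using decode n ij by (auto simp: B_def)
  have "B \<inter> {2*m..<3*m} = (+) (2 * m) ` set_decode s" using decode ij by (force simp: B_def)
  then have "thr_code m B = (\<Sum>k\<in>set_decode s. 2 ^ k)"
    by (simp add: thr_code_def sum.reindex)
  also have "\<dots> = real (set_encode (set_decode s))" by (simp add: set_encode_def)
  finally have code: "thr_code m B = s" by simp
  have "B \<inter> {m..<2*m} = {m + j}" using ij by (auto simp: B_def)
  then have "thr_load m t B i = (1 + s) / t (i, j)" by (simp add: thr_load_def code)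
  then have "lcp_orientation n (thr_matrix n m t) (vec n (thr_rhs m \<theta>)) B i \<longleftrightarrow> \<theta> < (1 + s) / t (i, j)"
    using B ij n by (simp add: lcp_orientation_def lcp_sol_thr thr_value_def)
  also have "\<dots> \<longleftrightarrow> \<theta> * t (i, j) < 1 + s" using t by (simp add: pos_less_divide_eq)
  \<comment> \<open>By the bounds on \<theta>, the product \<open>\<theta> * t (i, j)\<close> lies
    strictly between \<open>t (i, j)\<close> and \<open>t (i, j) + 1\<close>, so comparing it with
    \<open>1 + s\<close> is an integer comparison.\<close>
  also have "\<dots> \<longleftrightarrow> t (i, j) \<le> s"
  proof -
    have lower: "real (t (i, j)) < \<theta> * t (i, j)" using \<theta> t by simp
    have "real (t (i, j)) \<le> real (2 ^ m)" unfolding of_nat_le_iff by (rule t(2))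
    then have "(\<theta> - 1) * t (i, j) \<le> (\<theta> - 1) * 2 ^ m"
      using \<theta> by (intro mult_left_mono) simp_all
    also have "\<dots> < 1" using \<theta> by (simp add: field_simps)
    finally have upper: "\<theta> * t (i, j) < t (i, j) + 1" by (simp add: algebra_simps)
    show ?thesis
    proof
      assume "\<theta> * t (i, j) < 1 + s"
      with lower have "real (t (i, j)) < real (Suc s)" by simp
      then show "t (i, j) \<le> s" by simp
    next
      assume "t (i, j) \<le> s"
      then have "real (t (i, j)) \<le> real s" by simp
      with upper show "\<theta> * t (i, j) < 1 + s" by simp
    qed
  qed
  finally show ?thesis by (simp add: B_def)
qed

section \<open>Counting threshold arrays and the final asymptotics\<close>

lemma K_USOs_subset_P_USOs: "K_USOs n \<subseteq> P_USOs n"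
  by (auto simp: K_USOs_def P_USOs_def K_matrix_def)

lemma card_K_USOs_ge:
  assumes n: "3 * m \<le> n"
  shows "2 ^ m ^ 3 \<le> card (K_USOs n)"
proof -
  define T where "T = PiE ({..<m} \<times> {..<m}) (\<lambda>_. {1..2 ^ m :: nat})"
  \<comment> \<open>The choice of \<theta> depends on \<open>t\<close>, because the loads to be
    avoided do.\<close>
  have "\<forall>t. \<exists>\<theta>. 1 < \<theta> \<and> \<theta> < 1 + 1 / 2 ^ m \<and> (\<forall>B r. B \<subseteq> {..<n} \<longrightarrow> r < m \<longrightarrow> thr_load m t B r \<noteq> \<theta>)"
    using thr_generic by metis
  then obtain \<theta> where \<theta>: "\<And>t. 1 < \<theta> t" "\<And>t. \<theta> t < 1 + 1 / 2 ^ m"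
    "\<And>t B r. B \<subseteq> {..<n} \<Longrightarrow> r < m \<Longrightarrow> thr_load m t B r \<noteq> \<theta> t" by metis
  define U where "U = (\<lambda>t. lcp_orientation n (thr_matrix n m t) (vec n (thr_rhs m (\<theta> t))))"
  have "U ` T \<subseteq> K_USOs n"
    using thr_nondegenerate[OF n \<theta>(3)] nondegenerate_is_USO thr_matrix_K
    unfolding K_USOs_def U_def by blast
  moreover have "inj_on U T"
  proof (rule inj_onI)
    fix t t' assume t: "t \<in> T" "t' \<in> T" and eq: "U t = U t'"
    show "t = t'"
    proof (rule PiE_ext[OF t[unfolded T_def]])
      fix p assume "p \<in> {..<m} \<times> {..<m}"
      then obtain i j where p: "p = (i, j)" "i < m" "j < m" by auto
      have range: "1 \<le> t (i, j)" "t (i, j) \<le> 2 ^ m" "1 \<le> t' (i, j)" "t' (i, j) \<le> 2 ^ m"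
        using t p by (auto simp: T_def PiE_iff)
      have "t (i, j) \<le> s \<longleftrightarrow> t' (i, j) \<le> s" if "s < 2 ^ m" for s
        using thr_orientation[where t = t and i = i and j = j, OF n \<theta>(1,2)[of t] p(2,3) range(1,2) that]
          thr_orientation[where t = t' and i = i and j = j, OF n \<theta>(1,2)[of t'] p(2,3) range(3,4) that] eq
        by (simp add: U_def)
      \<comment> \<open>The smaller of two distinct thresholds is below \<open>2 ^ m\<close>, hence
        a legitimate query that separates them. The value \<open>2 ^ m\<close> itself is recognised
        by never being reached.\<close>
      from this[of "t (i, j)"] this[of "t' (i, j)"] show "t p = t' p"
        using range by (auto simp: p not_less le_less)
    qed
  qed
  moreover have "finite (K_USOs n)"
    using finite_P_USOs_and_card_le[of n] K_USOs_subset_P_USOs finite_subset by blast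
  ultimately have "card T \<le> card (K_USOs n)" by (metis card_inj_on_le)
  moreover have "card T = (2 ^ m) ^ (m * m)" by (simp add: T_def card_PiE card_cartesian_product)
  ultimately show ?thesis by (simp add: power3_eq_cube mult.assoc flip: power_mult)
qed

theorem mainTheorem5:
  shows "\<exists>c C n0. c > 0 \<and>
    (\<forall>n\<ge>n0. 2 powr (c * real n ^ 3) \<le> real (card (K_USOs n))
            \<and> real (card (K_USOs n)) \<le> 2 powr (C * real n ^ 3)
            \<and> 2 powr (c * real n ^ 3) \<le> real (card (P_USOs n))
            \<and> real (card (P_USOs n)) \<le> 2 powr (C * real n ^ 3))"
proof (rule exI[of _ "1 / 216"], rule exI[of _ 12], rule exI[of _ 3], intro conjI allI impI)
  fix n :: nat assume n: "n \<ge> 3"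
  have KP: "real (card (K_USOs n)) \<le> real (card (P_USOs n))"
    unfolding of_nat_le_iff using finite_P_USOs_and_card_le[of n]
    by (intro card_mono K_USOs_subset_P_USOs) simp
  have "real (card (P_USOs n)) \<le> real (2 ^ (12 * n ^ 3))"
    unfolding of_nat_le_iff using n by (intro card_P_USOs_le) simp
  also have "\<dots> = 2 powr real (12 * n ^ 3)" by (subst powr_realpow) simp_all
  finally show P: "real (card (P_USOs n)) \<le> 2 powr (12 * real n ^ 3)" by simp
  with KP show "real (card (K_USOs n)) \<le> 2 powr (12 * real n ^ 3)" by simp
  define m where "m = n div 3"
  \<comment> \<open>For \<open>n >= 3\<close> the quotient is at least 1, so
    \<open>n \<le> 3 * m + 2 \<le> 6 * m\<close>; this is the source of the constant 1 / 216, the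
    inverse of the cube of 6.\<close>
  have "n \<le> 6 * m" using n unfolding m_def by presburger
  then have "real n \<le> real (6 * m)" unfolding of_nat_le_iff .
  then have "real n ^ 3 \<le> (6 * real m) ^ 3" by (intro power_mono) simp_all
  then have "2 powr (1 / 216 * real n ^ 3) \<le> 2 powr real (m ^ 3)"
    by (intro powr_mono) (simp_all add: power_mult_distrib)
  also have "\<dots> = real (2 ^ m ^ 3)" by (subst powr_realpow) simp_all
  also have "\<dots> \<le> real (card (K_USOs n))"
    unfolding of_nat_le_iff by (intro card_K_USOs_ge) (simp add: m_def)
  finally show K: "2 powr (1 / 216 * real n ^ 3) \<le> real (card (K_USOs n))" .
  with KP show "2 powr (1 / 216 * real n ^ 3) \<le> real (card (P_USOs n))" by simp
qed simp

end
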